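(* Let $\Gamma$ be a locally finite connected hyperbolic graph with base vertex $x_0$, and let $G$ be a group acting properly and cocompactly by isometries on $\Gamma$. Make $\mathcal{A}(\Gamma)$ a self-similar tree in which two atoms have the same type iff some element of $G$ induces a morphism between them, and $\mathrm{Mor}(A,A')$ is the set of subtree isomorphisms $\mathcal{A}(\Gamma)_A\to\mathcal{A}(\Gamma)_{A'}$ induced by elements of $G$. Then for every $g\in G$, the homeomorphism $L_g=h\circ g\circ h^{-1}$ of $\partial\mathcal{A}(\Gamma)$ is rational.
   Context: $\Gamma$ is identified with its vertex set with path metric $d$; $d_x(y)=d(x,y)$. Proper means finite vertex stabilizers, and cocompact means finitely many vertex orbits. $B_n=\{x:d(x_0,x)\le n\}$. For finite $B$, the atom of $x$ is $\{y:d_y-d_x\text{ is constant on }B\}$. $\mathcal{A}_n(\Gamma)$ is the set of infinite atoms for $B=B_n$. $\mathcal{A}(\Gamma)$ is the rooted tree formed as the disjoint union of the $\mathcal{A}_n(\Gamma)$, with $A\in\mathcal{A}_{n+1}$ a child of $A'\in\mathcal{A}_n$ iff $A\subseteq A'$. For an atom $A$, $\mathcal{A}(\Gamma)_A$ is the subtree of $A$ and its descendants. $g$ induces a morphism from $A\in\mathcal{A}_m(\Gamma)$ to $A'\in\mathcal{A}_n(\Gamma)$ if three conditions hold: (i) $gA=A'$; (ii) $g(A\cap B_{m+k})=A'\cap B_{n+k}$ for all $k\ge0$; (iii) every $A_1\in\mathcal{A}_{m+k}(\Gamma)$ with $A_1\subseteq A$ (with $k>0$) is mapped by $g$ onto some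 $A_2\in\mathcal{A}_{n+k}(\Gamma)$ with $A_2\subseteq A'$. The resulting isomorphism $A_1\mapsto gA_1$ is the induced morphism. The horofunction boundary $\partial_h\Gamma$ is the set of limit points of $\{\overline{d_x}\}$ in $\mathbb{Z}^\Gamma$ (product topology) modulo constants, with $G$ acting by $(gf)(p)=f(g^{-1}p)$. $h\colon\partial_h\Gamma\to\partial\mathcal{A}(\Gamma)$ is the homeomorphism sending $\overline f$ to the descending path $(A_n)$, where $A_n\in\mathcal{A}_n(\Gamma)$ is the atom such that $f-d_y$ is constant on $B_n$ for $y\in A_n$. For a self-similar tree $T$, a homeomorphism $f\colon\partial T\to\partial T$ has equivalent restrictions at same-type vertices $v,w$ if there exist same-type vertices $x,y$ and morphisms $\varphi\colon T_v\to T_w$, $\psi\colon T_x\to T_y$ with $f(\partial T_v)\subseteq\partial T_x$, $f(\partial T_w)\subseteq\partial T_y$ and $f\circ\varphi_*=\psi_*\circ f$ on $\partial T_v$. $f$ is rational if this equivalence relation has finitely many classes. *)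

theory Defs
  imports "HOL-Analysis.Analysis" "HOL-Algebra.Group_Action"
begin

text \<open>A graph is given by a symmetric irreflexive adjacency relation E on the vertex type 'v.
  Walks are nonempty vertex lists with consecutive entries adjacent.\<close>

definition is_walk :: "('v \<Rightarrow> 'v \<Rightarrow> bool) \<Rightarrow> 'v list \<Rightarrow> 'v \<Rightarrow> 'v \<Rightarrow> bool" where
  "is_walk E xs x y \<longleftrightarrow> xs \<noteq> [] \<and> hd xs = x \<and> last xs = y \<and>
     (\<forall>i. Suc i < length xs \<longrightarrow> E (xs ! i) (xs ! Suc i))"

definition graph_connected :: "('v \<Rightarrow> 'v \<Rightarrow> bool) \<Rightarrow> bool" where
  "graph_connected E \<longleftrightarrow> (\<forall>x y. \<exists>xs. is_walk E xs x y)"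

definition locally_finite :: "('v \<Rightarrow> 'v \<Rightarrow> bool) \<Rightarrow> bool" where
  "locally_finite E \<longleftrightarrow> (\<forall>x. finite {y. E x y})"

definition gdist :: "('v \<Rightarrow> 'v \<Rightarrow> bool) \<Rightarrow> 'v \<Rightarrow> 'v \<Rightarrow> nat" where
  "gdist E x y = (LEAST n. \<exists>xs. is_walk E xs x y \<and> length xs = Suc n)"

definition gromov_prod :: "('v \<Rightarrow> 'v \<Rightarrow> bool) \<Rightarrow> 'v \<Rightarrow> 'v \<Rightarrow> 'v \<Rightarrow> real" where
  "gromov_prod E w x y = (real (gdist E w x) + real (gdist E w y) - real (gdist E x y)) / 2"

definition hyperbolic_graph :: "('v \<Rightarrow> 'v \<Rightarrow> bool) \<Rightarrow> bool" where
  "hyperbolic_graph E \<longleftrightarrow> (\<exists>\<delta>\<ge>0. \<forall>w x y z.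
      gromov_prod E w x z \<ge> min (gromov_prod E w x y) (gromov_prod E w y z) - \<delta>)"

definition ball :: "('v \<Rightarrow> 'v \<Rightarrow> bool) \<Rightarrow> 'v \<Rightarrow> nat \<Rightarrow> 'v set" where
  "ball E x0 n = {x. gdist E x0 x \<le> n}"

definition atom_of :: "('v \<Rightarrow> 'v \<Rightarrow> bool) \<Rightarrow> 'v set \<Rightarrow> 'v \<Rightarrow> 'v set" where
  "atom_of E B x = {y. \<exists>c::int. \<forall>b\<in>B. int (gdist E y b) - int (gdist E x b) = c}"

definition inf_atoms :: "('v \<Rightarrow> 'v \<Rightarrow> bool) \<Rightarrow> 'v \<Rightarrow> nat \<Rightarrow> 'v set set" where
  "inf_atoms E x0 n = {A. (\<exists>x. A = atom_of E (ball E x0 n) x) \<and> infinite A}"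

text \<open>Vertices of the tree \<open>\<A>(\<Gamma>)\<close>: disjoint union of the levels, tagged by level.\<close>
definition atree :: "('v \<Rightarrow> 'v \<Rightarrow> bool) \<Rightarrow> 'v \<Rightarrow> (nat \<times> 'v set) set" where
  "atree E x0 = {(n, A). A \<in> inf_atoms E x0 n}"

definition atree_bdry :: "('v \<Rightarrow> 'v \<Rightarrow> bool) \<Rightarrow> 'v \<Rightarrow> (nat \<Rightarrow> 'v set) set" where
  "atree_bdry E x0 = {\<xi>. \<forall>n. \<xi> n \<in> inf_atoms E x0 n \<and> \<xi> (Suc n) \<subseteq> \<xi> n}"

definition bdry_at :: "('v \<Rightarrow> 'v \<Rightarrow> bool) \<Rightarrow> 'v \<Rightarrow> nat \<times> 'v set \<Rightarrow> (nat \<Rightarrow> 'v set) set" where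
  "bdry_at E x0 v = {\<xi> \<in> atree_bdry E x0. \<xi> (fst v) = snd v}"

definition induces_mor ::
  "('v \<Rightarrow> 'v \<Rightarrow> bool) \<Rightarrow> 'v \<Rightarrow> ('g, 'b) monoid_scheme \<Rightarrow> ('g \<Rightarrow> 'v \<Rightarrow> 'v) \<Rightarrow> 'g
     \<Rightarrow> nat \<times> 'v set \<Rightarrow> nat \<times> 'v set \<Rightarrow> bool" where
  "induces_mor E x0 G \<phi> g v w \<longleftrightarrow>
     g \<in> carrier G \<and> v \<in> atree E x0 \<and> w \<in> atree E x0 \<and>
     \<phi> g ` snd v = snd w \<and>
     (\<forall>k. \<phi> g ` (snd v \<inter> ball E x0 (fst v + k)) = snd w \<inter> ball E x0 (fst w + k)) \<and>
     (\<forall>k>0. \<forall>A1 \<in> inf_atoms E x0 (fst v + k). A1 \<subseteq> snd v \<longrightarrow>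
         \<phi> g ` A1 \<in> inf_atoms E x0 (fst w + k) \<and> \<phi> g ` A1 \<subseteq> snd w)"

definition mor_push ::
  "('v \<Rightarrow> 'v \<Rightarrow> bool) \<Rightarrow> 'v \<Rightarrow> ('g \<Rightarrow> 'v \<Rightarrow> 'v) \<Rightarrow> 'g \<Rightarrow> nat \<times> 'v set \<Rightarrow> nat \<times> 'v set
     \<Rightarrow> (nat \<Rightarrow> 'v set) \<Rightarrow> (nat \<Rightarrow> 'v set)" where
  "mor_push E x0 \<phi> g v w \<xi> =
     (THE \<eta>. \<eta> \<in> atree_bdry E x0 \<and> (\<forall>k. \<eta> (fst w + k) = \<phi> g ` \<xi> (fst v + k)))"

text \<open>Equivalent restrictions, for the self-similar structure where Mor(v,w) consists of the
  morphisms induced by elements of G (same type iff some element of G induces a morphism).\<close>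
definition equiv_restr ::
  "('v \<Rightarrow> 'v \<Rightarrow> bool) \<Rightarrow> 'v \<Rightarrow> ('g, 'b) monoid_scheme \<Rightarrow> ('g \<Rightarrow> 'v \<Rightarrow> 'v)
     \<Rightarrow> ((nat \<Rightarrow> 'v set) \<Rightarrow> (nat \<Rightarrow> 'v set)) \<Rightarrow> nat \<times> 'v set \<Rightarrow> nat \<times> 'v set \<Rightarrow> bool" where
  "equiv_restr E x0 G \<phi> f v w \<longleftrightarrow>
     (\<exists>g1 x y g2. induces_mor E x0 G \<phi> g1 v w \<and> induces_mor E x0 G \<phi> g2 x y \<and>
        f ` bdry_at E x0 v \<subseteq> bdry_at E x0 x \<and> f ` bdry_at E x0 w \<subseteq> bdry_at E x0 y \<and>
        (\<forall>\<xi> \<in> bdry_at E x0 v. f (mor_push E x0 \<phi> g1 v w \<xi>) = mor_push E x0 \<phi> g2 x y (f \<xi>)))"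

definition rational_map ::
  "('v \<Rightarrow> 'v \<Rightarrow> bool) \<Rightarrow> 'v \<Rightarrow> ('g, 'b) monoid_scheme \<Rightarrow> ('g \<Rightarrow> 'v \<Rightarrow> 'v)
     \<Rightarrow> ((nat \<Rightarrow> 'v set) \<Rightarrow> (nat \<Rightarrow> 'v set)) \<Rightarrow> bool" where
  "rational_map E x0 G \<phi> f \<longleftrightarrow>
     finite (atree E x0 // {(v, w). equiv_restr E x0 G \<phi> f v w})"

text \<open>Classes modulo constants are represented by their normalisation vanishing at x0;
  \<open>'v \<Rightarrow> int\<close> carries the product topology.\<close>
definition horo_bdry :: "('v \<Rightarrow> 'v \<Rightarrow> bool) \<Rightarrow> 'v \<Rightarrow> ('v \<Rightarrow> int) set" where
  "horo_bdry E x0 = {f. f islimpt range (\<lambda>x p. int (gdist E x p) - int (gdist E x x0))}"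

text \<open>\<open>(g f)(p) = f(g^{-1} p)\<close>, renormalised at x0.\<close>
definition horo_act :: "'v \<Rightarrow> ('g, 'b) monoid_scheme \<Rightarrow> ('g \<Rightarrow> 'v \<Rightarrow> 'v) \<Rightarrow> 'g
     \<Rightarrow> ('v \<Rightarrow> int) \<Rightarrow> ('v \<Rightarrow> int)" where
  "horo_act x0 G \<phi> g f = (\<lambda>p. f (\<phi> (inv\<^bsub>G\<^esub> g) p) - f (\<phi> (inv\<^bsub>G\<^esub> g) x0))"

definition hmap :: "('v \<Rightarrow> 'v \<Rightarrow> bool) \<Rightarrow> 'v \<Rightarrow> ('v \<Rightarrow> int) \<Rightarrow> (nat \<Rightarrow> 'v set)" where
  "hmap E x0 f = (\<lambda>n. THE A. A \<in> inf_atoms E x0 n \<and>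
       (\<forall>y\<in>A. \<exists>c. \<forall>b\<in>ball E x0 n. f b - int (gdist E y b) = c))"

definition Lmap :: "('v \<Rightarrow> 'v \<Rightarrow> bool) \<Rightarrow> 'v \<Rightarrow> ('g, 'b) monoid_scheme \<Rightarrow> ('g \<Rightarrow> 'v \<Rightarrow> 'v) \<Rightarrow> 'g
     \<Rightarrow> (nat \<Rightarrow> 'v set) \<Rightarrow> (nat \<Rightarrow> 'v set)" where
  "Lmap E x0 G \<phi> g = (\<lambda>\<xi>. hmap E x0 (horo_act x0 G \<phi> g (inv_into (horo_bdry E x0) (hmap E x0) \<xi>)))"

end

theory Submission
  imports Defs
begin

text \<open>In a hyperbolic graph the restriction to a ball of the distance function to \<open>y\<close> is determined, up to
  a constant, by its values at bounded distance from a projection \<open>p\<close> of \<open>y\<close> to the ball; and a point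
  is such a projection as soon as it is one within bounded distance. Hence if \<open>g\<close> carries the pair
  (atom, distance to the base point) near \<open>p\<close> to the corresponding pair of another atom, then \<open>g\<close> induces a
  morphism. To obtain equivalent restrictions of the map given by \<open>a\<close>, record near \<open>p\<close> also the
  distance to \<open>a\<inverse> x0\<close>: if \<open>g\<close> preserves this too, then \<open>g\<close> and \<open>a g a\<inverse>\<close> both induce morphisms, on the
  source and on the target side. By cocompactness only finitely many such local pictures exist.\<close>

section \<open>The path metric\<close>

text \<open>\<open>Lmap\<close> does not preserve levels: with
  \<open>l = d x0 (\<phi> (inv a) x0)\<close> it sends the rays through an atom of level
  \<open>m\<close> into one of level \<open>m - l\<close>. Pulled back by \<open>a\<close>, that
  target belongs to a ball about \<open>a\<inverse> x0\<close>, so projections to balls with two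
  different centres have to be compared; this enlarges the radius of the local picture and makes
  \<open>2 * l\<close> the least level at which the comparison works. For this reason the geometry
  is written for balls about arbitrary centres, and a group element is removed from a statement
  about atoms by moving the centre. A second obstacle is that the target vertices in the equivalence
  of restrictions are existentially quantified: transitivity requires two choices of targets to be
  aligned by restricting a morphism.\<close>

lemma walk_iff_relpowp: "(\<exists>xs. is_walk E xs x y \<and> length xs = Suc n) \<longleftrightarrow> (E ^^ n) x y"
proof
  assume "\<exists>xs. is_walk E xs x y \<and> length xs = Suc n"
  then obtain xs where xs: "is_walk E xs x y" "length xs = Suc n" by blast
  then have "xs ! 0 = x" "xs ! n = y" "\<forall>i<n. E (xs ! i) (xs ! Suc i)"
    using last_conv_nth[of xs] by (auto simp: is_walk_def simp flip: hd_conv_nth)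
  then show "(E ^^ n) x y" unfolding relpowp_fun_conv by blast
next
  assume "(E ^^ n) x y"
  then obtain f where f: "f 0 = x" "f n = y" "\<forall>i<n. E (f i) (f (Suc i))"
    unfolding relpowp_fun_conv by blast
  have "is_walk E (map f [0..<Suc n]) x y"
    using f by (simp add: is_walk_def hd_map last_map del: upt_Suc)
  then show "\<exists>xs. is_walk E xs x y \<and> length xs = Suc n" by fastforce
qed

lemma gdist_eq_Least: "gdist E x y = (LEAST n. (E ^^ n) x y)"
  unfolding gdist_def walk_iff_relpowp ..

lemma gdist_le: "(E ^^ n) x y \<Longrightarrow> gdist E x y \<le> n"
  unfolding gdist_eq_Least by (rule Least_le)

lemma relpowp_gdist:
  assumes "graph_connected E"
  shows "(E ^^ gdist E x y) x y"
proof -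
  obtain xs where "is_walk E xs x y" using assms unfolding graph_connected_def by blast
  moreover from this have "length xs = Suc (length xs - 1)" by (simp add: is_walk_def)
  ultimately have "(E ^^ (length xs - 1)) x y" unfolding walk_iff_relpowp[symmetric] by blast
  then show ?thesis unfolding gdist_eq_Least by (rule LeastI)
qed

lemma finite_relpowp_image:
  assumes "locally_finite E"
  shows "finite {y. (E ^^ n) x y}"
proof (induction n)
  case (Suc n)
  have "{y. (E ^^ Suc n) x y} = (\<Union>z\<in>{z. (E ^^ n) x z}. {y. E z y})" by auto
  then show ?case using Suc assms by (simp add: locally_finite_def)
qed simp

lemma relpowp_sym:
  assumes "\<And>x y. E x y \<Longrightarrow> E y x" "(E ^^ n) x y"
  shows "(E ^^ n) y x"
  using assms(2)
proof (induction n arbitrary: y)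
  case (Suc n)
  then obtain z where "(E ^^ n) x z" "E z y" by auto
  then show ?case using Suc.IH assms(1) relpowp_Suc_I2 by metis
qed auto

text \<open>Walks enter the geometry only through \<open>geodesic\<close>, which gives a point at
  each integer distance along a shortest path. A natural number \<open>D\<close> keeps all estimates
  integral.\<close>

locale hyperbolic_space =
  fixes E :: "'v \<Rightarrow> 'v \<Rightarrow> bool" and d :: "'v \<Rightarrow> 'v \<Rightarrow> nat" and D :: nat
  defines "d \<equiv> gdist E"
  assumes d_refl [simp]: "d x x = 0"
    and d_zero: "d x y = 0 \<Longrightarrow> x = y"
    and d_sym: "d x y = d y x"
    and d_tri: "d x z \<le> d x y + d y z"
    and geodesic: "k \<le> d x y \<Longrightarrow> \<exists>z. d x z = k \<and> d x z + d z y = d x y"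
    and finite_ball: "finite {y. d x y \<le> n}"
    and four_point: "d x z + d w y \<le> d x y + d w z + D \<or> d x z + d w y \<le> d y z + d w x + D"

lemma hyperbolic_spaceI:
  assumes sym: "\<And>x y. E x y \<Longrightarrow> E y x"
    and locfin: "locally_finite E"
    and conn: "graph_connected E"
    and hyp: "hyperbolic_graph E"
  shows "\<exists>D. hyperbolic_space E D"
proof -
  let ?d = "gdist E"
  have tri: "?d x z \<le> ?d x y + ?d y z" for x y z
    by (rule gdist_le, rule relpowp_trans) (rule relpowp_gdist[OF conn])+
  have geo: "\<exists>z. ?d x z = k \<and> ?d x z + ?d z y = ?d x y" if "k \<le> ?d x y" for k x y
  proof -
    have "(E ^^ (k + (?d x y - k))) x y" using that relpowp_gdist[OF conn] by simp
    then obtain z where "(E ^^ k) x z" "(E ^^ (?d x y - k)) z y"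
      unfolding relpowp_add by (rule relcomppE)
    then have "?d x z \<le> k" "?d z y \<le> ?d x y - k" by (auto intro: gdist_le)
    then have "?d x z = k \<and> ?d x z + ?d z y = ?d x y" using tri[of x y z] that by linarith
    then show ?thesis by blast
  qed
  have fin: "finite {y. ?d x y \<le> n}" for x n
  proof (rule finite_subset)
    show "{y. ?d x y \<le> n} \<subseteq> (\<Union>k\<le>n. {y. (E ^^ k) x y})"
      using relpowp_gdist[OF conn, of x] by auto
  qed (simp add: finite_relpowp_image[OF locfin])
  obtain \<delta> where \<delta>: "\<And>w x y z. gromov_prod E w x z \<ge> min (gromov_prod E w x y) (gromov_prod E w y z) - \<delta>"
    using hyp unfolding hyperbolic_graph_def by blast
  \<comment> \<open>Doubling clears the halves in the Gromov products and leaves the distance form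
    \<open>four_point\<close> with error \<open>2 * \<delta>\<close>, rounded up.\<close>
  define D where "D = nat \<lceil>2 * \<delta>\<rceil>"
  have D: "2 * \<delta> \<le> real D" unfolding D_def by linarith
  have "?d x z + ?d w y \<le> ?d x y + ?d w z + D \<or> ?d x z + ?d w y \<le> ?d y z + ?d w x + D" for w x y z
    proof -
    have "real (?d x z) + real (?d w y) \<le> real (?d x y) + real (?d w z) + real D \<or>
        real (?d x z) + real (?d w y) \<le> real (?d y z) + real (?d w x) + real D"
      using \<delta>[of w x y z] D unfolding gromov_prod_def min_def by (simp split: if_splits) argo+
    then show ?thesis by linarith
  qed
  moreover have "?d x x = 0" for x
    using gdist_le[of 0 E x x] by simp
  moreover have "x = y" if "?d x y = 0" for x y
    using relpowp_gdist[OF conn, of x y] that by simp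
  moreover have "?d x y = ?d y x" for x y
    by (rule antisym; rule gdist_le[OF relpowp_sym[OF sym relpowp_gdist[OF conn]]])
  ultimately have "hyperbolic_space E D"
    using tri geo fin by (intro hyperbolic_space.intro) simp_all
  then show ?thesis ..
qed

context hyperbolic_space
begin

section \<open>Projections to balls\<close>

definition proj :: "'v \<Rightarrow> nat \<Rightarrow> 'v \<Rightarrow> 'v \<Rightarrow> bool" where
  "proj x m y p \<longleftrightarrow> d x p \<le> m \<and> (\<forall>b. d x b \<le> m \<longrightarrow> d y p \<le> d y b)"

lemma proj_in_ball: "proj x m y p \<Longrightarrow> d x p \<le> m"
  and proj_le: "proj x m y p \<Longrightarrow> d x b \<le> m \<Longrightarrow> d y p \<le> d y b"
  by (auto simp: proj_def)

lemma proj_exists: "\<exists>p. proj x m y p"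
proof -
  have "d x x \<le> m" by simp
  then obtain p where "d x p \<le> m" "\<And>b. d x b \<le> m \<Longrightarrow> d y p \<le> d y b"
    using arg_min_natI[of "\<lambda>b. d x b \<le> m" x "d y"] arg_min_nat_le[of "\<lambda>b. d x b \<le> m" _ "d y"]
    by blast
  then show ?thesis unfolding proj_def by blast
qed

text \<open>Apply the four-point condition to \<open>y\<close>, \<open>r\<close>, \<open>p\<close>,
  \<open>q\<close>: as \<open>d p q\<close> splits at \<open>r\<close>, one half cancels in each
  alternative.\<close>

lemma thin_point:
  assumes "d p r + d r q = d p q"
  shows "d y r + d p r \<le> d y p + D \<or> d y r + d r q \<le> d y q + D"
  using four_point[of y r p q] assms d_sym[of r q] d_sym[of p y] d_sym[of r p]
  by (elim disjE) linarith+

lemma ball_quasiconvex: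
  assumes "d p r + d r q = d p q" "d x p \<le> m" "d x q \<le> m" "D \<le> d p r" "D \<le> d r q"
  shows "d x r \<le> m"
  by (rule disjE[OF thin_point[OF assms(1), of x]]) (use assms in linarith)+

text \<open>The strict inequality \<open>D < K\<close> matters: a step of length \<open>K\<close>
  along a geodesic outweighs one error \<open>D\<close>.\<close>

definition K where "K = D + 1"

text \<open>Hyperbolicity makes a sufficiently local minimum of a distance function on a ball global: on a
  geodesic between two far apart points of the ball, the distance function drops strictly below
  the larger of its end values while staying in the ball.\<close>
lemma local_min_imp_proj:
  assumes "d x p \<le> m" and loc: "\<And>b. d x b \<le> m \<Longrightarrow> d p b \<le> 2 * K \<Longrightarrow> d y p \<le> d y b"
  shows "proj x m y p"
proof -
  obtain q where q: "proj x m y q" using proj_exists by blast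
  have "d y p \<le> d y q"
  proof (cases "d p q \<le> 2 * K")
    case True
    then show ?thesis using loc proj_in_ball[OF q] by blast
  next
    case False
    then obtain r where r: "d p r = K" "d p r + d r q = d p q"
      using geodesic[of K p q] by auto
    then have "d x r \<le> m"
      using ball_quasiconvex[OF r(2) assms(1) proj_in_ball[OF q]] False by (simp add: K_def)
    then have *: "d y p \<le> d y r" "d y q \<le> d y r" using loc r proj_le[OF q] by auto
    show ?thesis
      by (rule disjE[OF thin_point[OF r(2), of y]]) (use * r False K_def in linarith)+
  qed
  then show ?thesis using assms(1) q unfolding proj_def by (meson le_trans)
qed

text \<open>The point \<open>r\<close> at distance \<open>K\<close> from \<open>p\<close> towards
  \<open>b\<close> lies in the ball, so it is no closer to \<open>y\<close> than \<open>p\<close>.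
  As \<open>D < K\<close>, this excludes the first alternative of \<open>thin_point\<close>; the
  second bounds the detour through \<open>p\<close>.\<close>

lemma proj_lower_bound:
  assumes p: "proj x m y p" and b: "d x b \<le> m"
  shows "d y p + d p b \<le> d y b + 2 * K"
proof (cases "d p b \<le> 2 * K")
  case True
  then show ?thesis using proj_le[OF p b] by linarith
next
  case False
  then obtain r where r: "d p r = K" "d p r + d r b = d p b"
    using geodesic[of K p b] by auto
  then have "d x r \<le> m"
    using ball_quasiconvex[OF r(2) proj_in_ball[OF p] b] False by (simp add: K_def)
  then have *: "d y p \<le> d y r" using proj_le[OF p] by auto
  show ?thesis
    by (rule disjE[OF thin_point[OF r(2), of y]]) (use * r False K_def in linarith)+
qed

definition R0 where "R0 = 8 * K"

text \<open>Among the points of the ball lying on a geodesic from \<open>y\<close> to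
  \<open>b\<close>, take \<open>s\<close> nearest to \<open>y\<close>. If \<open>s\<close> were far
  from \<open>p\<close>, then stepping back from \<open>s\<close> towards \<open>y\<close> would
  also approach \<open>p\<close>, hence stay in the ball and contradict the choice of
  \<open>s\<close>.\<close>

lemma geodesic_enters_near_proj:
  assumes p: "proj x m y p" and b: "d x b \<le> m"
  shows "\<exists>s. d x s \<le> m \<and> d p s \<le> R0 \<and> d y s + d s b = d y b"
proof -
  define S where "S = {s. d x s \<le> m \<and> d y s + d s b = d y b}"
  have "b \<in> S" using b by (simp add: S_def)
  then obtain s where s: "s \<in> S" and smin: "\<And>r. r \<in> S \<Longrightarrow> d y s \<le> d y r"
    using arg_min_natI[of "\<lambda>s. s \<in> S" b "d y"] arg_min_nat_le[of "\<lambda>s. s \<in> S" _ "d y"] by blast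
  have "d p s \<le> R0"
  proof (rule ccontr)
    assume far: "\<not> d p s \<le> R0"
    have lb: "d y p + d p s \<le> d y s + 2 * K" using proj_lower_bound[OF p] s by (simp add: S_def)
    \<comment> \<open>Two errors \<open>D\<close> have to be absorbed: one in the
      \<open>thin_point\<close> estimate for \<open>p\<close>, one in the four-point estimate that
      puts \<open>r\<close> in the ball.\<close>
    define t where "t = 2 * K"
    have "d y s - t \<le> d y s" by simp
    then obtain r where r: "d y r = d y s - t" "d y r + d r s = d y s" using geodesic by blast
    have rs: "d r s = t" using r lb far R0_def t_def by linarith
    have "d p r + t \<le> d p s + D"
      by (rule disjE[OF thin_point[OF r(2), of p]])
        (use rs r lb far d_sym[of y p] R0_def t_def K_def in linarith)+
    moreover have "d x s \<le> m" using s by (simp add: S_def)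
    ultimately have "d x r \<le> m"
      using proj_in_ball[OF p] rs far d_sym[of s r] d_sym[of r s] four_point[of p s x r] t_def K_def R0_def
      by (elim disjE) linarith+
    moreover have "d y r + d r b = d y b"
      using s r d_tri[of r b s] d_tri[of y b r] unfolding S_def by auto
    ultimately have "r \<in> S" by (simp add: S_def)
    then show False using smin[of r] r rs unfolding t_def K_def by auto
  qed
  then show ?thesis using s by (auto simp: S_def)
qed

section \<open>Equality of distance functions on balls\<close>

text \<open>The relation whose classes are the atoms, for a ball with arbitrary centre
  \<open>x\<close>.\<close>

definition same :: "'v \<Rightarrow> nat \<Rightarrow> 'v \<Rightarrow> 'v \<Rightarrow> bool" where
  "same x m y z \<longleftrightarrow> (\<exists>c::int. \<forall>b. d x b \<le> m \<longrightarrow> int (d z b) - int (d y b) = c)"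

lemma same_iff:
  assumes "d x p \<le> m"
  shows "same x m y z \<longleftrightarrow> (\<forall>b. d x b \<le> m \<longrightarrow> d y b + d z p = d z b + d y p)"
proof
  assume "same x m y z"
  then obtain c where "\<And>b. d x b \<le> m \<Longrightarrow> int (d z b) - int (d y b) = c"
    unfolding same_def by blast
  from this this[OF assms] show "\<forall>b. d x b \<le> m \<longrightarrow> d y b + d z p = d z b + d y p" by force
next
  assume R: "\<forall>b. d x b \<le> m \<longrightarrow> d y b + d z p = d z b + d y p"
  show "same x m y z" unfolding same_def
    by (rule exI[of _ "int (d z p) - int (d y p)"]) (use R in force)
qed

lemma same_refl: "same x m y y"
  and same_sym: "same x m y z \<Longrightarrow> same x m z y"
  and same_trans: "same x m y z \<Longrightarrow> same x m z w \<Longrightarrow> same x m y w"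
proof -
  have same_iff': "same x m y z \<longleftrightarrow> (\<forall>b. d x b \<le> m \<longrightarrow> d y b + d z x = d z b + d y x)" for y z
    by (rule same_iff) simp
  show "same x m y y" "same x m y z \<Longrightarrow> same x m z y"
    unfolding same_iff' by auto
  show "same x m y w" if "same x m y z" "same x m z w"
    unfolding same_iff'
  proof (intro allI impI)
    fix b assume "d x b \<le> m"
    then have "d y b + d z x = d z b + d y x" "d z b + d w x = d w b + d z x"
      using that unfolding same_iff' by blast+
    then show "d y b + d w x = d w b + d y x" by linarith
  qed
qed

lemma same_antimono:
  assumes "same x m y z" "\<And>b. d x' b \<le> n \<Longrightarrow> d x b \<le> m"
  shows "same x' n y z"
  using assms unfolding same_def by meson

lemma same_proj:
  assumes "same x m y z" "proj x m y p"
  shows "proj x m z p"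
proof -
  have *: "d y b + d z p = d z b + d y p" if "d x b \<le> m" for b
    using assms same_iff[OF proj_in_ball[OF assms(2)]] that by blast
  show ?thesis unfolding proj_def
  proof (intro conjI allI impI)
    show "d x p \<le> m" using proj_in_ball[OF assms(2)] .
    show "d z p \<le> d z b" if "d x b \<le> m" for b
      using *[OF that] proj_le[OF assms(2) that] by linarith
  qed
qed

text \<open>Geodesics from \<open>y\<close> and from \<open>z\<close> to \<open>b\<close> pass
  through points \<open>s\<close> and \<open>t\<close> near \<open>p\<close>, where the two distance
  functions agree up to the constant. Routing through \<open>s\<close> bounds \<open>d z b\<close>
  in terms of \<open>d y b\<close>, and routing through \<open>t\<close> gives the reverse.\<close>

lemma same_if_same_near_proj:
  assumes y: "proj x m y p" and z: "proj x m z p"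
    and eq: "\<And>b. d x b \<le> m \<Longrightarrow> d p b \<le> R0 \<Longrightarrow> d y b + d z p = d z b + d y p"
  shows "same x m y z"
  unfolding same_iff[OF proj_in_ball[OF y]]
proof (intro allI impI)
  fix b assume b: "d x b \<le> m"
  obtain s where s: "d x s \<le> m" "d p s \<le> R0" "d y s + d s b = d y b"
    using geodesic_enters_near_proj[OF y b] by blast
  obtain t where t: "d x t \<le> m" "d p t \<le> R0" "d z t + d t b = d z b"
    using geodesic_enters_near_proj[OF z b] by blast
  show "d y b + d z p = d z b + d y p"
    using eq[OF s(1,2)] eq[OF t(1,2)] s(3) t(3) d_tri[of y b t] d_tri[of z b s] by linarith
qed

section \<open>Changing the base point\<close>

text \<open>An equality of the depth functions of two families of concentric balls, whose sublevel
  sets at \<open>k\<close> have radii \<open>m + k\<close> and \<open>n + k\<close>; the sums avoid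
  truncated subtraction.\<close>

definition agree :: "nat \<Rightarrow> 'v \<Rightarrow> 'v \<Rightarrow> nat \<Rightarrow> 'v \<Rightarrow> nat \<Rightarrow> bool" where
  "agree R p x m x' n \<longleftrightarrow> (\<forall>s. d p s \<le> R \<longrightarrow> d x s + n = d x' s + m)"

lemma agree_sym: "agree R p x m x' n \<Longrightarrow> agree R p x' n x m"
  by (auto simp: agree_def)

lemma agree_mono: "agree R p x m x' n \<Longrightarrow> R' \<le> R \<Longrightarrow> agree R' p x m x' n"
  by (auto simp: agree_def)

lemma agree_shift: "agree R p x m x' n \<Longrightarrow> d p q + R' \<le> R \<Longrightarrow> agree R' q x m x' n"
  unfolding agree_def using d_tri[of p _ q] by (meson add_left_mono le_trans)

lemma agree_ball_iff:
  assumes "agree R p x m x' n" "d p s \<le> R"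
  shows "d x s \<le> m + k \<longleftrightarrow> d x' s \<le> n + k"
proof -
  have "d x s + n = d x' s + m" using assms unfolding agree_def by blast
  then show ?thesis by linarith
qed

lemma agree_proj:
  assumes ag: "agree R p x m x' n" and R: "2 * K \<le> R" and p: "proj x m y p"
  shows "proj x' n y p"
proof (rule local_min_imp_proj)
  have *: "d p s \<le> R \<Longrightarrow> d x s \<le> m \<longleftrightarrow> d x' s \<le> n" for s
    using agree_ball_iff[OF ag, of s 0] by simp
  show "d x' p \<le> n" using * proj_in_ball[OF p] by simp
  show "d y p \<le> d y b" if "d x' b \<le> n" "d p b \<le> 2 * K" for b
    using * proj_le[OF p] that R by simp
qed

lemma agree_proj_iff:
  assumes "agree R p x m x' n" "2 * K \<le> R"
  shows "proj x m y p \<longleftrightarrow> proj x' n y p"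
  using agree_proj agree_sym assms by meson

lemma proj_eq_self: "proj x m y p \<Longrightarrow> d x y \<le> m \<Longrightarrow> y = p"
  using proj_le[of x m y p y] d_zero by auto

lemma proj_dist_outside:
  assumes p: "proj x m y p" and "y \<noteq> p"
  shows "d x y = m + d y p"
proof -
  have "m < d x y" using proj_eq_self assms by (meson not_less)
  then obtain b where "d x b = m" "d x b + d b y = d x y" using geodesic[of m x y] by auto
  then show ?thesis
    using proj_le[OF p, of b] proj_in_ball[OF p] d_tri[of x y p] d_sym[of p y] d_sym[of b y] by linarith
qed

text \<open>The vertex \<open>y\<close> may be arbitrarily far from \<open>p\<close>: if it differs
  from \<open>p\<close>, its distance to either centre is the radius plus \<open>d y p\<close>,
  since \<open>p\<close> is its projection to both balls.\<close>

lemma agree_dist: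
  assumes ag: "agree R p x m x' n" and R: "2 * K \<le> R" and p: "proj x m y p"
  shows "d x y + n = d x' y + m"
proof (cases "y = p")
  case True
  then show ?thesis using ag unfolding agree_def by simp
next
  case False
  then show ?thesis using proj_dist_outside[OF p] proj_dist_outside[OF agree_proj[OF ag R p]] by linarith
qed

text \<open>In \<open>agree_same\<close>, a point within \<open>R0\<close> of \<open>q\<close>
  projects to some \<open>p'\<close> with \<open>d p p' \<le> 2 * R0 + 2 * K\<close>; another
  \<open>2 * K\<close> is needed for \<open>p'\<close> to be recognised as a projection to the other
  ball too.\<close>

definition R1 where "R1 = 2 * R0 + 4 * K"

text \<open>Agreement near \<open>p\<close> propagates outwards to every larger radius. Points near
  \<open>q\<close>, the projection of \<open>y\<close> to the ball of radius \<open>m + k\<close>,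
  project to points near \<open>p\<close>, so \<open>agree_dist\<close> makes the depth functions
  agree around \<open>q\<close>, where \<open>same_if_same_near_proj\<close> applies.\<close>

lemma agree_same:
  assumes ag: "agree R1 p x m x' n" and y: "proj x m y p" and same: "same x (m + k) y z"
  shows "same x' (n + k) y z"
proof -
  \<comment> \<open>The minimum covers the case that \<open>y\<close> already lies in the larger
    ball; then \<open>q\<close> is \<open>y\<close>.\<close>
  obtain q where q: "d p q = min k (d p y)" "d p q + d q y = d p y"
    using geodesic[of "min k (d p y)" p y] by auto
  have proj_q: "proj x (m + k) y q" unfolding proj_def
  proof (intro conjI allI impI)
    show "d x q \<le> m + k" using q(1) d_tri[of x q p] proj_in_ball[OF y] by linarith
    show "d y q \<le> d y b" if b: "d x b \<le> m + k" for b
    proof (cases "k < d p y")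
      case True
      then have "y \<noteq> p" by auto
      then have "d x y = m + d y p" using proj_dist_outside[OF y] by blast
      then show ?thesis using b q True d_tri[of x y b] d_sym[of b y] d_sym[of q y] d_sym[of p y] by linarith
    next
      case False
      then show ?thesis using q d_zero[of q y] by auto
    qed
  qed
  have q_to_p: "proj x m q p" unfolding proj_def
  proof (intro conjI allI impI)
    show "d x p \<le> m" using proj_in_ball[OF y] .
    show "d q p \<le> d q b" if "d x b \<le> m" for b
      using proj_le[OF y that] q(2) d_tri[of y b q] d_sym[of q y] d_sym[of p y] d_sym[of p q] by linarith
  qed
  have ag_q: "agree R0 q x (m + k) x' (n + k)" unfolding agree_def
  proof (intro allI impI)
    fix r assume r: "d q r \<le> R0"
    obtain p' where p': "proj x m r p'" using proj_exists by blast
    have "d p p' + 2 * K \<le> R1"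
      using proj_lower_bound[OF q_to_p proj_in_ball[OF p']] proj_le[OF p' proj_in_ball[OF y]]
        r d_tri[of q p' r] d_tri[of r p q] d_sym[of r q] R1_def by linarith
    then show "d x r + (n + k) = d x' r + (m + k)"
      using agree_dist[OF agree_shift[OF ag] order_refl p'] by simp
  qed
  have K_R0: "2 * K \<le> R0" by (simp add: R0_def)
  have proj_z: "proj x (m + k) z q" using same_proj[OF same proj_q] .
  show ?thesis
  proof (rule same_if_same_near_proj)
    show "proj x' (n + k) y q" "proj x' (n + k) z q"
      using agree_proj[OF ag_q K_R0] proj_q proj_z by blast+
    show "d y b + d z q = d z b + d y q" if b: "d x' b \<le> n + k" "d q b \<le> R0" for b
    proof -
      have "d x b \<le> m + k" using agree_ball_iff[OF ag_q b(2), of 0] b(1) by simp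
      then show ?thesis using same same_iff[OF proj_in_ball[OF proj_q]] by blast
    qed
  qed
qed

lemma agree_same_iff:
  assumes "agree R1 p x m x' n" "proj x m y p"
  shows "same x (m + k) y z \<longleftrightarrow> same x' (n + k) y z"
proof -
  have "proj x' n y p" using agree_proj[OF assms(1) _ assms(2)] by (simp add: R1_def)
  then show ?thesis using agree_same[OF assms] agree_same[OF agree_sym[OF assms(1)]] by blast
qed

end

lemma finite_image_factor:
  assumes "finite (r ` S)" "\<And>x y. x \<in> S \<Longrightarrow> y \<in> S \<Longrightarrow> r x = r y \<Longrightarrow> f x = f y"
  shows "finite (f ` S)"
proof -
  have "f ` S \<subseteq> (\<lambda>t. f (inv_into S r t)) ` r ` S"
  proof
    fix u assume "u \<in> f ` S"
    then obtain x where x: "x \<in> S" "u = f x" by blast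
    then have "f (inv_into S r (r x)) = f x"
      using assms(2) by (meson f_inv_into_f imageI inv_into_into)
    then show "u \<in> (\<lambda>t. f (inv_into S r t)) ` r ` S" using x by force
  qed
  then show ?thesis using assms(1) finite_surj finite_subset finite_imageI by blast
qed

locale hyperbolic_action = hyperbolic_space +
  fixes x0 :: 'a and G (structure) and \<phi> :: "'c \<Rightarrow> 'a \<Rightarrow> 'a"
  assumes act: "group_action G UNIV \<phi>"
    and isom: "h \<in> carrier G \<Longrightarrow> d (\<phi> h x) (\<phi> h y) = d x y"
begin

section \<open>Atoms and the boundary of the tree of atoms\<close>

lemma in_ball_iff: "y \<in> ball E x n \<longleftrightarrow> d x y \<le> n"
  by (simp add: ball_def d_def)

definition atom :: "nat \<Rightarrow> 'a \<Rightarrow> 'a set" where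
  "atom n y = {z. same x0 n y z}"

lemma in_atom_iff: "z \<in> atom n y \<longleftrightarrow> same x0 n y z"
  by (simp add: atom_def)

lemma atom_of_ball: "atom_of E (ball E x0 n) y = atom n y"
  unfolding atom_of_def atom_def same_def Ball_def in_ball_iff d_def ..

lemma inf_atoms_iff: "A \<in> inf_atoms E x0 n \<longleftrightarrow> (\<exists>y. A = atom n y) \<and> infinite A"
  unfolding inf_atoms_def atom_of_ball by simp

lemma atom_self: "y \<in> atom n y"
  by (simp add: in_atom_iff same_refl)

lemma atom_eqI: "z \<in> atom n y \<Longrightarrow> atom n z = atom n y"
  unfolding atom_def using same_sym same_trans by blast

lemma atom_mono: "m \<le> n \<Longrightarrow> atom n y \<subseteq> atom m y"
  unfolding atom_def using same_antimono[of x0 n y _ x0 m] by auto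

lemma inf_atom_eq_atom: "A \<in> inf_atoms E x0 n \<Longrightarrow> y \<in> A \<Longrightarrow> A = atom n y"
  using atom_eqI unfolding inf_atoms_iff by blast

lemma inf_atom_eqI:
  "A \<in> inf_atoms E x0 n \<Longrightarrow> A' \<in> inf_atoms E x0 n \<Longrightarrow> y \<in> A \<Longrightarrow> y \<in> A' \<Longrightarrow> A = A'"
  using inf_atom_eq_atom by blast

lemma inf_atom_nonempty: "A \<in> inf_atoms E x0 n \<Longrightarrow> \<exists>y. y \<in> A"
  unfolding inf_atoms_iff using atom_self by blast

lemma inf_atom_coarser:
  assumes "A \<in> inf_atoms E x0 n" "y \<in> A" "m \<le> n"
  shows "atom m y \<in> inf_atoms E x0 m" "A \<subseteq> atom m y"
proof -
  show "A \<subseteq> atom m y" using inf_atom_eq_atom[OF assms(1,2)] atom_mono[OF assms(3)] by simp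
  then show "atom m y \<in> inf_atoms E x0 m"
    using assms(1) infinite_super unfolding inf_atoms_iff by blast
qed

text \<open>The distance function normalised at \<open>x0\<close> takes values between
  \<open>-n\<close> and \<open>n\<close> on the ball, and its restriction there determines the
  atom.\<close>

lemma finite_atoms: "finite (range (atom n))"
proof (rule finite_image_factor)
  let ?r = "\<lambda>y. restrict (\<lambda>b. int (d y b) - int (d y x0)) (ball E x0 n)"
  have "range ?r \<subseteq> ball E x0 n \<rightarrow>\<^sub>E {- int n..int n}"
  proof (rule image_subsetI, rule restrict_PiE_iff[THEN iffD2], rule ballI)
    fix y b assume "b \<in> ball E x0 n"
    then show "int (d y b) - int (d y x0) \<in> {- int n..int n}"
      using d_tri[of y b x0] d_tri[of y x0 b] d_sym[of b x0] by (simp add: in_ball_iff)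
  qed
  moreover have "finite (ball E x0 n \<rightarrow>\<^sub>E {- int n..int n})"
    using finite_ball[of x0 n] by (intro finite_PiE) (simp_all add: ball_def d_def)
  ultimately show "finite (range ?r)" by (rule finite_subset)
  show "atom n y = atom n z" if "?r y = ?r z" for y z
  proof -
    have "int (d z b) - int (d y b) = int (d z x0) - int (d y x0)" if "d x0 b \<le> n" for b
      using fun_cong[OF \<open>?r y = ?r z\<close>, of b] that by (simp add: in_ball_iff)
    then have "z \<in> atom n y" unfolding in_atom_iff same_def by blast
    then show ?thesis using atom_eqI by blast
  qed
qed

lemma finite_inf_atoms: "finite (inf_atoms E x0 n)"
  by (rule finite_subset[OF _ finite_atoms[of n]]) (auto simp: inf_atoms_iff)

text \<open>Pigeonhole over the finitely many atoms covering \<open>S\<close>. It yields infinite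
  children of infinite atoms and the preimage atom in \<open>induces_mor_inv\<close>.\<close>

lemma infinite_set_meets_inf_atom:
  assumes "infinite S"
  shows "\<exists>A\<in>inf_atoms E x0 n. infinite (A \<inter> S)"
proof (rule ccontr)
  assume no: "\<not> ?thesis"
  have "finite (atom n y \<inter> S)" for y
  proof (rule ccontr)
    assume inf: "infinite (atom n y \<inter> S)"
    then have "atom n y \<in> inf_atoms E x0 n" unfolding inf_atoms_iff by auto
    then show False using inf no by blast
  qed
  then have "finite (\<Union>A\<in>range (atom n). A \<inter> S)" by (intro finite_UN_I[OF finite_atoms]) auto
  moreover have "S \<subseteq> (\<Union>A\<in>range (atom n). A \<inter> S)" using atom_self by blast
  ultimately show False using assms finite_subset by blast
qed

lemma inf_atom_child:
  assumes "A \<in> inf_atoms E x0 n"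
  shows "\<exists>A'\<in>inf_atoms E x0 (Suc n). A' \<subseteq> A"
proof -
  have "infinite A" using assms by (simp add: inf_atoms_iff)
  then obtain A' where A': "A' \<in> inf_atoms E x0 (Suc n)" "infinite (A' \<inter> A)"
    using infinite_set_meets_inf_atom[of A "Suc n"] by blast
  then have "A' \<inter> A \<noteq> {}" by (metis finite.emptyI)
  then obtain y where y: "y \<in> A'" "y \<in> A" by blast
  then have "A' \<subseteq> atom n y" using inf_atom_coarser(2)[OF A'(1)] by simp
  then show ?thesis using A'(1) inf_atom_eq_atom[OF assms y(2)] by blast
qed

lemma bdry_inf_atom: "\<xi> \<in> atree_bdry E x0 \<Longrightarrow> \<xi> n \<in> inf_atoms E x0 n"
  by (simp add: atree_bdry_def)

lemma bdry_antimono: "\<xi> \<in> atree_bdry E x0 \<Longrightarrow> m \<le> n \<Longrightarrow> \<xi> n \<subseteq> \<xi> m"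
  by (rule lift_Suc_antimono_le) (auto simp: atree_bdry_def)

text \<open>Atoms of one level are equal or disjoint and rays decrease, so common points at
  arbitrarily deep levels suffice.\<close>

lemma bdry_eqI:
  assumes \<xi>: "\<xi> \<in> atree_bdry E x0" and \<eta>: "\<eta> \<in> atree_bdry E x0"
    and meet: "\<And>k. \<exists>j\<ge>k. \<exists>y. y \<in> \<xi> j \<and> y \<in> \<eta> j"
  shows "\<xi> = \<eta>"
proof
  fix n
  obtain j y where "j \<ge> n" "y \<in> \<xi> j" "y \<in> \<eta> j" using meet by blast
  then have "y \<in> \<xi> n" "y \<in> \<eta> n" using bdry_antimono \<xi> \<eta> by blast+
  then show "\<xi> n = \<eta> n" using inf_atom_eqI bdry_inf_atom \<xi> \<eta> by blast
qed

text \<open>The levels before \<open>m\<close> are forced: they are the coarser atoms of any point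
  of \<open>C 0\<close>.\<close>

lemma bdry_from_chain:
  assumes C: "\<And>k. C k \<in> inf_atoms E x0 (m + k)" and dec: "\<And>k. C (Suc k) \<subseteq> C k"
  shows "\<exists>\<xi>\<in>atree_bdry E x0. \<forall>k. \<xi> (m + k) = C k"
proof -
  have C0: "C 0 \<in> inf_atoms E x0 m" using C[of 0] by simp
  then obtain y where y: "y \<in> C 0" using inf_atom_nonempty by blast
  define \<xi> where "\<xi> j = (if j < m then atom j y else C (j - m))" for j
  have "\<xi> n \<in> inf_atoms E x0 n" for n
    using inf_atom_coarser(1)[OF C0 y, of n] C[of "n - m"] by (cases "n < m") (simp_all add: \<xi>_def)
  moreover have "\<xi> (Suc n) \<subseteq> \<xi> n" for n
  proof -
    consider "Suc n < m" | "Suc n = m" | "m \<le> n" by linarith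
    then show ?thesis
    proof cases
      case 1
      then show ?thesis using atom_mono by (simp add: \<xi>_def)
    next
      case 2
      then show ?thesis using inf_atom_coarser(2)[OF C0 y, of n] by (auto simp: \<xi>_def)
    next
      case 3
      then show ?thesis using dec[of "n - m"] by (simp add: \<xi>_def Suc_diff_le)
    qed
  qed
  ultimately show ?thesis by (intro bexI[of _ \<xi>]) (auto simp: atree_bdry_def \<xi>_def)
qed

text \<open>Infinite atoms have infinite children, so dependent choice builds a ray. Such rays show
  that two target vertices are comparable in \<open>restr_wit_trans\<close>, and that target atoms
  are infinite.\<close>

lemma bdry_at_nonempty:
  assumes "v \<in> atree E x0"
  shows "\<exists>\<xi>. \<xi> \<in> bdry_at E x0 v"
proof -
  define m where "m = fst v"
  have v: "snd v \<in> inf_atoms E x0 m" using assms by (auto simp: atree_def m_def)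
  obtain C where C: "C 0 = snd v" "\<And>k. C k \<in> inf_atoms E x0 (m + k) \<and> C (Suc k) \<subseteq> C k"
  proof -
    have "\<exists>C. \<forall>k. (C k \<in> inf_atoms E x0 (m + k) \<and> (k = 0 \<longrightarrow> C k = snd v)) \<and> C (Suc k) \<subseteq> C k"
    proof (rule dependent_nat_choice)
      show "\<exists>A. A \<in> inf_atoms E x0 (m + 0) \<and> (0 = 0 \<longrightarrow> A = snd v)" using v by auto
      show "\<exists>A'. (A' \<in> inf_atoms E x0 (m + Suc k) \<and> (Suc k = 0 \<longrightarrow> A' = snd v)) \<and> A' \<subseteq> A"
        if "A \<in> inf_atoms E x0 (m + k) \<and> (k = 0 \<longrightarrow> A = snd v)" for A k
        using inf_atom_child[of A "m + k"] that by simp blast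
    qed
    then show ?thesis using that by blast
  qed
  have "\<exists>\<xi>\<in>atree_bdry E x0. \<forall>k. \<xi> (m + k) = C k"
    by (rule bdry_from_chain) (simp_all add: C(2))
  then obtain \<xi> where \<xi>: "\<xi> \<in> atree_bdry E x0" "\<forall>k. \<xi> (m + k) = C k" by blast
  then have "\<xi> m = snd v" using C(1) by (metis add_0_right)
  then show ?thesis using \<xi>(1) by (auto simp: bdry_at_def m_def)
qed

lemma bdry_at_bdry: "\<xi> \<in> bdry_at E x0 v \<Longrightarrow> \<xi> \<in> atree_bdry E x0"
  and bdry_at_level: "\<xi> \<in> bdry_at E x0 v \<Longrightarrow> \<xi> (fst v) = snd v"
  by (auto simp: bdry_at_def)

section \<open>The action on vertices\<close>

lemma group_G: "group G"
  using act group_action.group_hom group_hom.axioms(1) by blast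

lemma inv_closed: "h \<in> carrier G \<Longrightarrow> inv h \<in> carrier G"
  and mult_closed: "h \<in> carrier G \<Longrightarrow> k \<in> carrier G \<Longrightarrow> h \<otimes> k \<in> carrier G"
  and inv_inv: "h \<in> carrier G \<Longrightarrow> inv (inv h) = h"
  by (fact group.inv_closed[OF group_G] monoid.m_closed[OF group.is_monoid[OF group_G]]
      group.inv_inv[OF group_G])+

lemma act_mult: "h \<in> carrier G \<Longrightarrow> k \<in> carrier G \<Longrightarrow> \<phi> (h \<otimes> k) x = \<phi> h (\<phi> k x)"
  using group_action.composition_rule[OF act] by simp

lemma act_inv_left: "h \<in> carrier G \<Longrightarrow> \<phi> (inv h) (\<phi> h x) = x"
  using group_action.orbit_sym_aux[OF act] by simp

lemma act_inv_right: "h \<in> carrier G \<Longrightarrow> \<phi> h (\<phi> (inv h) x) = x"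
  using act_inv_left[OF inv_closed, of h x] by (simp add: inv_inv)

lemma act_inj: "h \<in> carrier G \<Longrightarrow> inj (\<phi> h)"
  by (rule inj_on_inverseI[of _ "\<phi> (inv h)"]) (rule act_inv_left)

lemma dist_inv_act: "h \<in> carrier G \<Longrightarrow> d (\<phi> (inv h) x) y = d x (\<phi> h y)"
  using isom[of h "\<phi> (inv h) x" y] act_inv_right by simp

lemma dist_act_inv: "h \<in> carrier G \<Longrightarrow> d x (\<phi> (inv h) y) = d (\<phi> h x) y"
  using dist_inv_act[of h y x] d_sym[of x] d_sym[of y] by simp

lemma image_act_inv_left: "h \<in> carrier G \<Longrightarrow> \<phi> (inv h) ` \<phi> h ` S = S"
  by (simp add: image_image act_inv_left)

lemma image_act_mult: "h \<in> carrier G \<Longrightarrow> k \<in> carrier G \<Longrightarrow> \<phi> (h \<otimes> k) ` S = \<phi> h ` \<phi> k ` S"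
  by (simp add: image_image act_mult)

lemma infinite_image_act: "h \<in> carrier G \<Longrightarrow> infinite (\<phi> h ` S) \<longleftrightarrow> infinite S"
  using finite_image_iff[OF inj_on_subset[OF act_inj]] by simp

section \<open>Morphisms induced by group elements\<close>

lemma induces_mor_carrier: "induces_mor E x0 G \<phi> g v w \<Longrightarrow> g \<in> carrier G"
  and induces_mor_source: "induces_mor E x0 G \<phi> g v w \<Longrightarrow> v \<in> atree E x0"
  and induces_mor_target: "induces_mor E x0 G \<phi> g v w \<Longrightarrow> w \<in> atree E x0"
  and induces_mor_image: "induces_mor E x0 G \<phi> g v w \<Longrightarrow> \<phi> g ` snd v = snd w"
  and induces_mor_ball: "induces_mor E x0 G \<phi> g v w \<Longrightarrow>
    \<phi> g ` (snd v \<inter> ball E x0 (fst v + k)) = snd w \<inter> ball E x0 (fst w + k)"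
  by (simp_all add: induces_mor_def)

lemma atree_inf_atom: "v \<in> atree E x0 \<Longrightarrow> snd v \<in> inf_atoms E x0 (fst v)"
  by (auto simp: atree_def)

text \<open>The definition of \<open>induces_mor\<close> speaks of \<open>k > 0\<close> only; for
  \<open>k = 0\<close> the atom is that of the vertex itself.\<close>

lemma induces_mor_inf_atom:
  assumes "induces_mor E x0 G \<phi> g v w" "A \<in> inf_atoms E x0 (fst v + k)" "A \<subseteq> snd v"
  shows "\<phi> g ` A \<in> inf_atoms E x0 (fst w + k)"
proof (cases "k = 0")
  case True
  obtain y where "y \<in> A" using inf_atom_nonempty[OF assms(2)] by blast
  then have "A = snd v"
    using inf_atom_eqI[of A "fst v" "snd v" y] assms atree_inf_atom[OF induces_mor_source[OF assms(1)]] True by auto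
  then show ?thesis
    using True induces_mor_image[OF assms(1)] atree_inf_atom[OF induces_mor_target[OF assms(1)]] by simp
next
  case False
  then show ?thesis using assms unfolding induces_mor_def by blast
qed

lemma induces_morI:
  assumes "g \<in> carrier G" "v \<in> atree E x0" "w \<in> atree E x0" "\<phi> g ` snd v = snd w"
    and "\<And>k. \<phi> g ` (snd v \<inter> ball E x0 (fst v + k)) = snd w \<inter> ball E x0 (fst w + k)"
    and "\<And>k A. A \<in> inf_atoms E x0 (fst v + k) \<Longrightarrow> A \<subseteq> snd v \<Longrightarrow> \<phi> g ` A \<in> inf_atoms E x0 (fst w + k)"
  shows "induces_mor E x0 G \<phi> g v w"
  using assms unfolding induces_mor_def by blast

text \<open>Surjectivity on infinite descendants holds because only finitely many atoms of each
  level are lost when the finite ones are discarded.\<close>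
lemma induces_mor_inv:
  assumes ind: "induces_mor E x0 G \<phi> g v w"
  shows "induces_mor E x0 G \<phi> (inv g) w v"
proof (rule induces_morI)
  have g: "g \<in> carrier G" using induces_mor_carrier[OF ind] .
  show "inv g \<in> carrier G" using inv_closed[OF g] .
  show "w \<in> atree E x0" "v \<in> atree E x0" by (fact induces_mor_source[OF ind] induces_mor_target[OF ind])+
  show "\<phi> (inv g) ` snd w = snd v"
    unfolding induces_mor_image[OF ind, symmetric] image_act_inv_left[OF g] ..
  show "\<phi> (inv g) ` (snd w \<inter> ball E x0 (fst w + k)) = snd v \<inter> ball E x0 (fst v + k)" for k
    unfolding induces_mor_ball[OF ind, symmetric] image_act_inv_left[OF g] ..
  show "\<phi> (inv g) ` A \<in> inf_atoms E x0 (fst v + k)"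
    if A: "A \<in> inf_atoms E x0 (fst w + k)" "A \<subseteq> snd w" for k A
  proof -
    have "infinite (\<phi> (inv g) ` A)"
      using A(1) infinite_image_act[OF inv_closed[OF g]] by (simp add: inf_atoms_iff)
    then obtain C where C: "C \<in> inf_atoms E x0 (fst v + k)" "infinite (C \<inter> \<phi> (inv g) ` A)"
      using infinite_set_meets_inf_atom by blast
    then have "C \<inter> \<phi> (inv g) ` A \<noteq> {}" by (metis finite.emptyI)
    then obtain y where y: "y \<in> C" "y \<in> \<phi> (inv g) ` A" by blast
    then have "y \<in> \<phi> (inv g) ` snd w" using A(2) by blast
    then have "y \<in> snd v" unfolding induces_mor_image[OF ind, symmetric] image_act_inv_left[OF g] .
    then have "C \<subseteq> snd v"
      using inf_atom_coarser(2)[OF C(1) y(1), of "fst v"]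
        inf_atom_eq_atom[OF atree_inf_atom[OF induces_mor_source[OF ind]]] by simp
    then have "\<phi> g ` C \<in> inf_atoms E x0 (fst w + k)" using induces_mor_inf_atom[OF ind C(1)] by blast
    moreover have "\<phi> g y \<in> A" "\<phi> g y \<in> \<phi> g ` C" using y act_inv_right[OF g] by auto
    ultimately have "\<phi> g ` C = A" using inf_atom_eqI[OF _ A(1), of "\<phi> g ` C" "\<phi> g y"] by simp
    then show ?thesis using C(1) image_act_inv_left[OF g, of C] by simp
  qed
qed

lemma induces_mor_comp:
  assumes g: "induces_mor E x0 G \<phi> g v w" and h: "induces_mor E x0 G \<phi> h w u"
  shows "induces_mor E x0 G \<phi> (h \<otimes> g) v u"
proof (rule induces_morI)
  note [simp] = image_act_mult[OF induces_mor_carrier[OF h] induces_mor_carrier[OF g]]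
  show "h \<otimes> g \<in> carrier G" using mult_closed induces_mor_carrier g h by blast
  show "v \<in> atree E x0" "u \<in> atree E x0" by (fact induces_mor_source[OF g] induces_mor_target[OF h])+
  show "\<phi> (h \<otimes> g) ` snd v = snd u" by (simp add: induces_mor_image[OF g] induces_mor_image[OF h])
  show "\<phi> (h \<otimes> g) ` (snd v \<inter> ball E x0 (fst v + k)) = snd u \<inter> ball E x0 (fst u + k)" for k
    by (simp add: induces_mor_ball[OF g] induces_mor_ball[OF h])
  show "\<phi> (h \<otimes> g) ` A \<in> inf_atoms E x0 (fst u + k)"
    if A: "A \<in> inf_atoms E x0 (fst v + k)" "A \<subseteq> snd v" for k A
    using induces_mor_inf_atom[OF h induces_mor_inf_atom[OF g A]] A(2) induces_mor_image[OF g] by auto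
qed

text \<open>Serves transitivity, where a morphism between target vertices is cut down to a deeper
  vertex on the same ray.\<close>

lemma induces_mor_restrict:
  assumes g: "induces_mor E x0 G \<phi> g v w"
    and v': "v' \<in> atree E x0" "fst v' = fst v + k" "snd v' \<subseteq> snd v"
  shows "induces_mor E x0 G \<phi> g v' (fst w + k, \<phi> g ` snd v')"
proof (rule induces_morI)
  show "g \<in> carrier G" "v' \<in> atree E x0" by (fact induces_mor_carrier[OF g] v'(1))+
  show "(fst w + k, \<phi> g ` snd v') \<in> atree E x0"
    using induces_mor_inf_atom[OF g _ v'(3), of k] atree_inf_atom[OF v'(1)] v'(2) by (simp add: atree_def)
  show "\<phi> g ` snd v' = snd (fst w + k, \<phi> g ` snd v')" by simp
  show "\<phi> g ` (snd v' \<inter> ball E x0 (fst v' + j)) =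
      snd (fst w + k, \<phi> g ` snd v') \<inter> ball E x0 (fst (fst w + k, \<phi> g ` snd v') + j)" for j
  proof -
    have inj: "\<phi> g ` (S \<inter> T) = \<phi> g ` S \<inter> \<phi> g ` T" for S T
      using act_inj[OF induces_mor_carrier[OF g]] by (rule image_Int)
    have "\<phi> g ` (snd v' \<inter> ball E x0 (fst v' + j))
        = \<phi> g ` (snd v' \<inter> (snd v \<inter> ball E x0 (fst v + (k + j))))"
      using v'(2,3) by (simp add: add.assoc inf.absorb1 flip: Int_assoc)
    also have "\<dots> = \<phi> g ` snd v' \<inter> (snd w \<inter> ball E x0 (fst w + (k + j)))"
      unfolding inj induces_mor_ball[OF g, symmetric] ..
    also have "\<dots> = \<phi> g ` snd v' \<inter> ball E x0 (fst w + (k + j))"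
      using v'(3) induces_mor_image[OF g] by blast
    finally show ?thesis by (simp add: add.assoc)
  qed
  show "\<phi> g ` A \<in> inf_atoms E x0 (fst (fst w + k, \<phi> g ` snd v') + j)"
    if "A \<in> inf_atoms E x0 (fst v' + j)" "A \<subseteq> snd v'" for j A
    using induces_mor_inf_atom[OF g, of A "k + j"] that v'(2,3) by (simp add: add.assoc)
qed

text \<open>The definite description in \<open>mor_push\<close> is met: the images form a chain
  starting at \<open>w\<close>, and a ray is determined by its tail.\<close>

lemma mor_push_works:
  assumes ind: "induces_mor E x0 G \<phi> g v w" and \<xi>: "\<xi> \<in> bdry_at E x0 v"
  shows "mor_push E x0 \<phi> g v w \<xi> \<in> bdry_at E x0 w"
    and "mor_push E x0 \<phi> g v w \<xi> (fst w + k) = \<phi> g ` \<xi> (fst v + k)"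
proof -
  let ?P = "\<lambda>\<eta>. \<eta> \<in> atree_bdry E x0 \<and> (\<forall>k. \<eta> (fst w + k) = \<phi> g ` \<xi> (fst v + k))"
  have \<xi>b: "\<xi> \<in> atree_bdry E x0" using bdry_at_bdry[OF \<xi>] .
  have "\<xi> (fst v + k) \<subseteq> snd v" for k
    using bdry_antimono[OF \<xi>b, of "fst v" "fst v + k"] bdry_at_level[OF \<xi>] by simp
  then have "\<phi> g ` \<xi> (fst v + k) \<in> inf_atoms E x0 (fst w + k)" for k
    using induces_mor_inf_atom[OF ind] bdry_inf_atom[OF \<xi>b] by blast
  moreover have "\<phi> g ` \<xi> (fst v + Suc k) \<subseteq> \<phi> g ` \<xi> (fst v + k)" for k
    by (rule image_mono, rule bdry_antimono[OF \<xi>b]) simp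
  ultimately have "\<exists>\<eta>\<in>atree_bdry E x0. \<forall>k. \<eta> (fst w + k) = \<phi> g ` \<xi> (fst v + k)"
    by (rule bdry_from_chain)
  then obtain \<eta> where \<eta>: "?P \<eta>" by blast
  moreover have "\<eta>' = \<eta>" if "?P \<eta>'" for \<eta>'
  proof (rule bdry_eqI)
    show "\<eta>' \<in> atree_bdry E x0" "\<eta> \<in> atree_bdry E x0" using that \<eta> by blast+
    show "\<exists>j\<ge>k. \<exists>y. y \<in> \<eta>' j \<and> y \<in> \<eta> j" for k
    proof -
      have "\<eta>' (fst w + k) = \<eta> (fst w + k)" using that \<eta> by simp
      then show ?thesis using inf_atom_nonempty bdry_inf_atom \<eta> by (metis le_add2)
    qed
  qed
  ultimately have P: "?P (mor_push E x0 \<phi> g v w \<xi>)" unfolding mor_push_def by (rule theI)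
  then show "mor_push E x0 \<phi> g v w \<xi> (fst w + k) = \<phi> g ` \<xi> (fst v + k)" by blast
  have "mor_push E x0 \<phi> g v w \<xi> (fst w) = snd w"
    using P bdry_at_level[OF \<xi>] induces_mor_image[OF ind] by (metis add_0_right)
  then show "mor_push E x0 \<phi> g v w \<xi> \<in> bdry_at E x0 w" using P by (simp add: bdry_at_def)
qed

lemma mor_push_eqI:
  assumes ind: "induces_mor E x0 G \<phi> g v w" and \<xi>: "\<xi> \<in> bdry_at E x0 v"
    and \<eta>: "\<eta> \<in> atree_bdry E x0"
    and meet: "\<And>k. k \<ge> k0 \<Longrightarrow> \<exists>y\<in>\<xi> (fst v + k). \<phi> g y \<in> \<eta> (fst w + k)"
  shows "mor_push E x0 \<phi> g v w \<xi> = \<eta>"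
proof (rule bdry_eqI)
  show "mor_push E x0 \<phi> g v w \<xi> \<in> atree_bdry E x0"
    using bdry_at_bdry mor_push_works(1)[OF ind \<xi>] by blast
  show "\<eta> \<in> atree_bdry E x0" using \<eta> .
  show "\<exists>j\<ge>k. \<exists>y. y \<in> mor_push E x0 \<phi> g v w \<xi> j \<and> y \<in> \<eta> j" for k
  proof -
    obtain y where "y \<in> \<xi> (fst v + (k + k0))" "\<phi> g y \<in> \<eta> (fst w + (k + k0))"
      using meet[of "k + k0"] by auto
    then have "\<phi> g y \<in> mor_push E x0 \<phi> g v w \<xi> (fst w + (k + k0)) \<and> \<phi> g y \<in> \<eta> (fst w + (k + k0))"
      unfolding mor_push_works(2)[OF ind \<xi>] by blast
    then show ?thesis by (intro exI[of _ "fst w + (k + k0)"]) auto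
  qed
qed

lemma mor_push_inv:
  assumes ind: "induces_mor E x0 G \<phi> g v w" and \<xi>: "\<xi> \<in> bdry_at E x0 v"
  shows "mor_push E x0 \<phi> (inv g) w v (mor_push E x0 \<phi> g v w \<xi>) = \<xi>"
proof (rule mor_push_eqI[OF induces_mor_inv[OF ind] mor_push_works(1)[OF ind \<xi>] bdry_at_bdry[OF \<xi>]])
  fix k
  obtain y where "y \<in> \<xi> (fst v + k)"
    using inf_atom_nonempty bdry_inf_atom bdry_at_bdry[OF \<xi>] by blast
  then show "\<exists>y\<in>mor_push E x0 \<phi> g v w \<xi> (fst w + k). \<phi> (inv g) y \<in> \<xi> (fst v + k)"
    unfolding mor_push_works(2)[OF ind \<xi>] using act_inv_left[OF induces_mor_carrier[OF ind]] by auto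
qed

lemma mor_push_inv':
  assumes ind: "induces_mor E x0 G \<phi> g v w" and \<eta>: "\<eta> \<in> bdry_at E x0 w"
  shows "mor_push E x0 \<phi> g v w (mor_push E x0 \<phi> (inv g) w v \<eta>) = \<eta>"
  using mor_push_inv[OF induces_mor_inv[OF ind] \<eta>] inv_inv[OF induces_mor_carrier[OF ind]] by simp

lemma mor_push_comp:
  assumes g: "induces_mor E x0 G \<phi> g v w" and h: "induces_mor E x0 G \<phi> h w u"
    and \<xi>: "\<xi> \<in> bdry_at E x0 v"
  shows "mor_push E x0 \<phi> (h \<otimes> g) v u \<xi> = mor_push E x0 \<phi> h w u (mor_push E x0 \<phi> g v w \<xi>)"
proof (rule mor_push_eqI[OF induces_mor_comp[OF g h] \<xi>])
  note push = mor_push_works[OF g \<xi>]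
  show "mor_push E x0 \<phi> h w u (mor_push E x0 \<phi> g v w \<xi>) \<in> atree_bdry E x0"
    using bdry_at_bdry mor_push_works(1)[OF h push(1)] by blast
  fix k
  obtain y where "y \<in> \<xi> (fst v + k)"
    using inf_atom_nonempty bdry_inf_atom bdry_at_bdry[OF \<xi>] by blast
  then show "\<exists>y\<in>\<xi> (fst v + k). \<phi> (h \<otimes> g) y \<in> mor_push E x0 \<phi> h w u (mor_push E x0 \<phi> g v w \<xi>) (fst u + k)"
    unfolding mor_push_works(2)[OF h push(1)] push(2)
    using act_mult[OF induces_mor_carrier[OF h] induces_mor_carrier[OF g]] by auto
qed

lemma mor_push_restrict:
  assumes g: "induces_mor E x0 G \<phi> g v w"
    and v': "v' \<in> atree E x0" "fst v' = fst v + k" "snd v' \<subseteq> snd v" and \<xi>: "\<xi> \<in> bdry_at E x0 v'"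
  shows "\<xi> \<in> bdry_at E x0 v"
    and "mor_push E x0 \<phi> g v' (fst w + k, \<phi> g ` snd v') \<xi> = mor_push E x0 \<phi> g v w \<xi>"
proof -
  obtain y where y: "y \<in> snd v'" using atree_inf_atom[OF v'(1)] inf_atom_nonempty by blast
  then have "y \<in> \<xi> (fst v)"
    using bdry_antimono[OF bdry_at_bdry[OF \<xi>], of "fst v" "fst v'"] bdry_at_level[OF \<xi>] v'(2) by auto
  then have "\<xi> (fst v) = snd v"
    using inf_atom_eqI bdry_inf_atom[OF bdry_at_bdry[OF \<xi>]]
      atree_inf_atom[OF induces_mor_source[OF g]] y v'(3) by blast
  then show \<xi>v: "\<xi> \<in> bdry_at E x0 v" using bdry_at_bdry[OF \<xi>] by (simp add: bdry_at_def)
  show "mor_push E x0 \<phi> g v' (fst w + k, \<phi> g ` snd v') \<xi> = mor_push E x0 \<phi> g v w \<xi>"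
  proof (rule mor_push_eqI[OF induces_mor_restrict[OF g v'] \<xi>])
    show "mor_push E x0 \<phi> g v w \<xi> \<in> atree_bdry E x0"
      using bdry_at_bdry mor_push_works(1)[OF g \<xi>v] by blast
    fix j
    obtain y where "y \<in> \<xi> (fst v' + j)"
      using inf_atom_nonempty bdry_inf_atom bdry_at_bdry[OF \<xi>] by blast
    then show "\<exists>y\<in>\<xi> (fst v' + j). \<phi> g y \<in> mor_push E x0 \<phi> g v w \<xi> (fst (fst w + k, \<phi> g ` snd v') + j)"
      using mor_push_works(2)[OF g \<xi>v, of "k + j"] v'(2) by (auto simp: add.assoc)
  qed
qed

section \<open>Equivalence of restrictions\<close>

text \<open>\<open>equiv_restr\<close> with its witnesses exposed, because transitivity depends on
  the levels of the target vertices.\<close>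

definition restr_wit where
  "restr_wit f v w g1 x y g2 \<longleftrightarrow>
     induces_mor E x0 G \<phi> g1 v w \<and> induces_mor E x0 G \<phi> g2 x y \<and>
     f ` bdry_at E x0 v \<subseteq> bdry_at E x0 x \<and> f ` bdry_at E x0 w \<subseteq> bdry_at E x0 y \<and>
     (\<forall>\<xi> \<in> bdry_at E x0 v. f (mor_push E x0 \<phi> g1 v w \<xi>) = mor_push E x0 \<phi> g2 x y (f \<xi>))"

lemma equiv_restr_iff_wit: "equiv_restr E x0 G \<phi> f v w \<longleftrightarrow> (\<exists>g1 x y g2. restr_wit f v w g1 x y g2)"
  unfolding equiv_restr_def restr_wit_def ..

lemma restr_wit_sym:
  assumes "restr_wit f v w g1 x y g2"
  shows "restr_wit f w v (inv g1) y x (inv g2)"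
proof -
  have g1: "induces_mor E x0 G \<phi> g1 v w" and g2: "induces_mor E x0 G \<phi> g2 x y"
    and fv: "f ` bdry_at E x0 v \<subseteq> bdry_at E x0 x" and fw: "f ` bdry_at E x0 w \<subseteq> bdry_at E x0 y"
    and comm: "\<And>\<xi>. \<xi> \<in> bdry_at E x0 v \<Longrightarrow> f (mor_push E x0 \<phi> g1 v w \<xi>) = mor_push E x0 \<phi> g2 x y (f \<xi>)"
    using assms unfolding restr_wit_def by blast+
  have "f (mor_push E x0 \<phi> (inv g1) w v \<eta>) = mor_push E x0 \<phi> (inv g2) y x (f \<eta>)"
    if \<eta>: "\<eta> \<in> bdry_at E x0 w" for \<eta>
  proof -
    define \<xi> where "\<xi> = mor_push E x0 \<phi> (inv g1) w v \<eta>"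
    have \<xi>: "\<xi> \<in> bdry_at E x0 v" unfolding \<xi>_def using mor_push_works(1)[OF induces_mor_inv[OF g1] \<eta>] .
    have "f \<eta> = mor_push E x0 \<phi> g2 x y (f \<xi>)"
      using comm[OF \<xi>] mor_push_inv'[OF g1 \<eta>] by (simp add: \<xi>_def)
    then show ?thesis using mor_push_inv[OF g2] \<xi> fv by (auto simp: \<xi>_def)
  qed
  then show ?thesis
    unfolding restr_wit_def using induces_mor_inv[OF g1] induces_mor_inv[OF g2] fv fw by blast
qed

text \<open>Both \<open>y\<close> and \<open>x'\<close> lie on the image of any ray through
  \<open>w\<close>, hence are comparable. If \<open>x'\<close> is the coarser one, \<open>h2\<close>
  restricts to \<open>y\<close> and the two commuting squares compose.\<close>

lemma restr_wit_trans:
  assumes 1: "restr_wit f v w g1 x y g2" and 2: "restr_wit f w u h1 x' y' h2"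
    and below: "fst x' \<le> fst y"
  shows "equiv_restr E x0 G \<phi> f v u"
proof -
  have g1: "induces_mor E x0 G \<phi> g1 v w" and g2: "induces_mor E x0 G \<phi> g2 x y"
    and fv: "f ` bdry_at E x0 v \<subseteq> bdry_at E x0 x" and fw: "f ` bdry_at E x0 w \<subseteq> bdry_at E x0 y"
    and comm1: "\<And>\<xi>. \<xi> \<in> bdry_at E x0 v \<Longrightarrow> f (mor_push E x0 \<phi> g1 v w \<xi>) = mor_push E x0 \<phi> g2 x y (f \<xi>)"
    using 1 unfolding restr_wit_def by blast+
  have h1: "induces_mor E x0 G \<phi> h1 w u" and h2: "induces_mor E x0 G \<phi> h2 x' y'"
    and fw': "f ` bdry_at E x0 w \<subseteq> bdry_at E x0 x'"
    and comm2: "\<And>\<xi>. \<xi> \<in> bdry_at E x0 w \<Longrightarrow> f (mor_push E x0 \<phi> h1 w u \<xi>) = mor_push E x0 \<phi> h2 x' y' (f \<xi>)"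
    using 2 unfolding restr_wit_def by blast+
  obtain \<eta> where "\<eta> \<in> bdry_at E x0 w" using bdry_at_nonempty induces_mor_source[OF h1] by blast
  then have \<eta>: "f \<eta> \<in> bdry_at E x0 y" "f \<eta> \<in> bdry_at E x0 x'" using fw fw' by blast+
  define k where "k = fst y - fst x'"
  have y: "y \<in> atree E x0" "fst y = fst x' + k" "snd y \<subseteq> snd x'"
    using below induces_mor_target[OF g2] bdry_antimono[OF bdry_at_bdry[OF \<eta>(1)] below]
      bdry_at_level[OF \<eta>(1)] bdry_at_level[OF \<eta>(2)] by (auto simp: k_def)
  define y'' where "y'' = (fst y' + k, \<phi> h2 ` snd y)"
  have h2': "induces_mor E x0 G \<phi> h2 y y''" unfolding y''_def using induces_mor_restrict[OF h2 y] .
  have comm2': "f (mor_push E x0 \<phi> h1 w u \<xi>) = mor_push E x0 \<phi> h2 y y'' (f \<xi>)"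
    if "\<xi> \<in> bdry_at E x0 w" for \<xi>
    using comm2[OF that] mor_push_restrict(2)[OF h2 y, of "f \<xi>"] fw that unfolding y''_def by auto
  \<comment> \<open>Pulling \<open>\<zeta>\<close> back to \<open>w\<close> by the inverse morphism
    reduces the inclusion at \<open>y''\<close> to the known one at \<open>y\<close>.\<close>
  have "f \<zeta> \<in> bdry_at E x0 y''" if \<zeta>: "\<zeta> \<in> bdry_at E x0 u" for \<zeta>
  proof -
    define \<xi> where "\<xi> = mor_push E x0 \<phi> (inv h1) u w \<zeta>"
    have \<xi>: "\<xi> \<in> bdry_at E x0 w" unfolding \<xi>_def using mor_push_works(1)[OF induces_mor_inv[OF h1] \<zeta>] .
    have "f \<zeta> = mor_push E x0 \<phi> h2 y y'' (f \<xi>)"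
      using comm2'[OF \<xi>] mor_push_inv'[OF h1 \<zeta>] by (simp add: \<xi>_def)
    then show ?thesis using mor_push_works(1)[OF h2'] \<xi> fw by auto
  qed
  moreover have "f (mor_push E x0 \<phi> (h1 \<otimes> g1) v u \<xi>) = mor_push E x0 \<phi> (h2 \<otimes> g2) x y'' (f \<xi>)"
    if \<xi>: "\<xi> \<in> bdry_at E x0 v" for \<xi>
  proof -
    have "f \<xi> \<in> bdry_at E x0 x" using fv \<xi> by blast
    then show ?thesis
      unfolding mor_push_comp[OF g1 h1 \<xi>] comm2'[OF mor_push_works(1)[OF g1 \<xi>]] comm1[OF \<xi>]
      by (rule mor_push_comp[OF g2 h2', symmetric])
  qed
  ultimately have "restr_wit f v u (h1 \<otimes> g1) x y'' (h2 \<otimes> g2)"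
    unfolding restr_wit_def using induces_mor_comp[OF g1 h1] induces_mor_comp[OF g2 h2'] fv by blast
  then show ?thesis unfolding equiv_restr_iff_wit by blast
qed

lemma equiv_restr_sym: "equiv_restr E x0 G \<phi> f v w \<Longrightarrow> equiv_restr E x0 G \<phi> f w v"
  unfolding equiv_restr_iff_wit using restr_wit_sym by blast

lemma equiv_restr_trans:
  assumes "equiv_restr E x0 G \<phi> f v w" "equiv_restr E x0 G \<phi> f w u"
  shows "equiv_restr E x0 G \<phi> f v u"
proof -
  obtain g1 x y g2 h1 x' y' h2 where 1: "restr_wit f v w g1 x y g2" and 2: "restr_wit f w u h1 x' y' h2"
    using assms unfolding equiv_restr_iff_wit by blast
  show ?thesis
  proof (cases "fst x' \<le> fst y")
    case True
    then show ?thesis using restr_wit_trans[OF 1 2] by blast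
  next
    case False
    \<comment> \<open>Reversing both squares exchanges the roles of \<open>x'\<close> and
      \<open>y\<close>.\<close>
    then have "equiv_restr E x0 G \<phi> f u v"
      using restr_wit_trans[OF restr_wit_sym[OF 2] restr_wit_sym[OF 1]] by simp
    then show ?thesis by (rule equiv_restr_sym)
  qed
qed

section \<open>Horofunctions\<close>

definition ndist :: "'a \<Rightarrow> 'a \<Rightarrow> int" where
  "ndist y p = int (d y p) - int (d y x0)"

lemma horo_bdry_eq: "horo_bdry E x0 = {f. f islimpt range ndist}"
  unfolding horo_bdry_def ndist_def d_def ..

lemma ndist_x0 [simp]: "ndist y x0 = 0"
  by (simp add: ndist_def)

lemma ndist_inj: "ndist y = ndist z \<Longrightarrow> y = z"
proof -
  assume "ndist y = ndist z"
  then have "ndist y y = ndist z y" "ndist y z = ndist z z" by simp_all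
  then show "y = z" using d_zero[of y z] d_sym[of y z] by (simp add: ndist_def)
qed

lemma open_agree: "finite S \<Longrightarrow> open {f' :: 'a \<Rightarrow> int. \<forall>b\<in>S. f' b = f b}"
  using product_topology_basis'[of S "\<lambda>b. {f b}" "\<lambda>b. b"] by (simp add: open_discrete)

text \<open>A basic neighbourhood in the product of discrete spaces constrains finitely many
  coordinates, all of them in some ball about \<open>x0\<close>.\<close>

lemma horo_bdry_iff:
  "f \<in> horo_bdry E x0 \<longleftrightarrow>
    f x0 = 0 \<and> (\<forall>n. infinite {y. \<forall>b. d x0 b \<le> n \<longrightarrow> f b = ndist y b})"
proof (intro iffI conjI allI)
  assume "f \<in> horo_bdry E x0"
  then have lim: "\<exists>y. ndist y \<in> U \<and> ndist y \<noteq> f" if "f \<in> U" "open U" for U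
    using that unfolding horo_bdry_eq islimpt_def by blast
  obtain y where "ndist y \<in> {f'. \<forall>b\<in>{x0}. f' b = f b}"
    using lim[OF _ open_agree[of "{x0}" f]] by auto
  then show "f x0 = 0" by simp
  fix n
  show "infinite {y. \<forall>b. d x0 b \<le> n \<longrightarrow> f b = ndist y b}" (is "infinite ?Y")
  proof
    assume fin: "finite ?Y"
    \<comment> \<open>If only finitely many vertices matched \<open>f\<close> on the ball, adding
      for each one with \<open>ndist y \<noteq> f\<close> a point where it differs would give a
      neighbourhood that excludes them all.\<close>
    define q where "q y = (SOME q. ndist y q \<noteq> f q)" for y
    have q: "ndist y (q y) \<noteq> f (q y)" if "ndist y \<noteq> f" for y
      unfolding q_def by (rule someI_ex) (use that in auto)
    have "finite ({b. d x0 b \<le> n} \<union> q ` ?Y)" using fin finite_ball by blast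
    then obtain y where y: "\<forall>b\<in>{b. d x0 b \<le> n} \<union> q ` ?Y. ndist y b = f b" "ndist y \<noteq> f"
      using lim[OF _ open_agree[of "{b. d x0 b \<le> n} \<union> q ` ?Y" f]] by auto
    then have "y \<in> ?Y" by simp
    then have "ndist y (q y) = f (q y)" using y(1) by blast
    then show False using q[OF y(2)] by blast
  qed
next
  assume f: "f x0 = 0 \<and> (\<forall>n. infinite {y. \<forall>b. d x0 b \<le> n \<longrightarrow> f b = ndist y b})"
  have "f islimpt range ndist"
  proof (rule islimptI)
    fix T assume T: "f \<in> T" "open T"
    then obtain X where X: "f \<in> (\<Pi>\<^sub>E i\<in>UNIV. X i)" "finite {i. X i \<noteq> UNIV}" "(\<Pi>\<^sub>E i\<in>UNIV. X i) \<subseteq> T"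
      using product_topology_open_contains_basis[of "\<lambda>_. euclidean" UNIV T f]
      unfolding open_fun_def by auto
    have "finite (d x0 ` {i. X i \<noteq> UNIV})" using X(2) by (rule finite_imageI)
    then obtain n where n: "\<And>i. X i \<noteq> UNIV \<Longrightarrow> d x0 i \<le> n"
      unfolding finite_nat_set_iff_bounded_le by blast
    have near: "ndist y \<in> T" if "\<forall>b. d x0 b \<le> n \<longrightarrow> f b = ndist y b" for y
    proof -
      have "ndist y i \<in> X i" for i
      proof (cases "X i = UNIV")
        case False
        then have "ndist y i = f i" using n that by simp
        then show ?thesis using X(1) by (metis PiE_mem UNIV_I)
      qed simp
      then show ?thesis using X(3) by auto
    qed
    have "infinite {y. \<forall>b. d x0 b \<le> n \<longrightarrow> f b = ndist y b}" (is "infinite ?Y") using f by blast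
    \<comment> \<open>A limit point needs approximants other than \<open>f\<close>; by injectivity
      of \<open>ndist\<close> at most one vertex is lost.\<close>
    moreover have "finite {y. ndist y = f}"
    proof (cases "\<exists>z. ndist z = f")
      case True
      then obtain z where "ndist z = f" by blast
      then have "{y. ndist y = f} \<subseteq> {z}" using ndist_inj by auto
      then show ?thesis using finite_subset by blast
    qed simp
    ultimately have "infinite (?Y - {y. ndist y = f})" by simp
    then have "?Y - {y. ndist y = f} \<noteq> {}" by (metis finite.emptyI)
    then obtain y where y: "\<forall>b. d x0 b \<le> n \<longrightarrow> f b = ndist y b" "ndist y \<noteq> f" by blast
    show "\<exists>f'\<in>range ndist. f' \<in> T \<and> f' \<noteq> f" using near[OF y(1)] y(2) by blast
  qed
  then show "f \<in> horo_bdry E x0" by (simp add: horo_bdry_eq)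
qed

text \<open>The set that the description in \<open>hmap\<close> singles out: empty or a whole atom
  for any \<open>f\<close>, an infinite atom for a horofunction.\<close>

definition horo_atom :: "('a \<Rightarrow> int) \<Rightarrow> nat \<Rightarrow> 'a set" where
  "horo_atom f n = {y. \<exists>c. \<forall>b. d x0 b \<le> n \<longrightarrow> f b - int (d y b) = c}"

lemma horo_atom_eq_atom:
  assumes "y \<in> horo_atom f n"
  shows "horo_atom f n = atom n y"
proof -
  obtain c where c: "\<And>b. d x0 b \<le> n \<Longrightarrow> f b - int (d y b) = c"
    using assms unfolding horo_atom_def by blast
  show ?thesis
  proof (intro equalityI subsetI)
    fix z assume "z \<in> horo_atom f n"
    then obtain c' where c': "\<And>b. d x0 b \<le> n \<Longrightarrow> f b - int (d z b) = c'"
      unfolding horo_atom_def by blast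
    have "int (d z b) - int (d y b) = c - c'" if "d x0 b \<le> n" for b
      using c[OF that] c'[OF that] by linarith
    then show "z \<in> atom n y" unfolding in_atom_iff same_def by blast
  next
    fix z assume "z \<in> atom n y"
    then obtain c' where c': "\<And>b. d x0 b \<le> n \<Longrightarrow> int (d z b) - int (d y b) = c'"
      unfolding in_atom_iff same_def by blast
    have "f b - int (d z b) = c - c'" if "d x0 b \<le> n" for b
      using c[OF that] c'[OF that] by linarith
    then show "z \<in> horo_atom f n" unfolding horo_atom_def by blast
  qed
qed

lemma agree_in_horo_atom: "{y. \<forall>b. d x0 b \<le> n \<longrightarrow> f b = ndist y b} \<subseteq> horo_atom f n"
proof
  fix y assume y: "y \<in> {y. \<forall>b. d x0 b \<le> n \<longrightarrow> f b = ndist y b}"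
  have "f b - int (d y b) = - int (d y x0)" if "d x0 b \<le> n" for b
    using y that by (simp add: ndist_def)
  then show "y \<in> horo_atom f n" unfolding horo_atom_def by blast
qed

lemma horo_atom_inf_atom:
  assumes "f \<in> horo_bdry E x0"
  shows "horo_atom f n \<in> inf_atoms E x0 n"
proof -
  have "infinite {y. \<forall>b. d x0 b \<le> n \<longrightarrow> f b = ndist y b}" using assms unfolding horo_bdry_iff by blast
  then have inf: "infinite (horo_atom f n)" using agree_in_horo_atom infinite_super by blast
  then have "horo_atom f n \<noteq> {}" by (metis finite.emptyI)
  then obtain y where "y \<in> horo_atom f n" by blast
  then show ?thesis unfolding inf_atoms_iff using horo_atom_eq_atom inf by blast
qed

lemma hmap_eq:
  assumes "f \<in> horo_bdry E x0"
  shows "hmap E x0 f = horo_atom f"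
proof
  fix n
  have horo_atom_iff: "(\<exists>c. \<forall>b\<in>ball E x0 n. f b - int (gdist E y b) = c) \<longleftrightarrow> y \<in> horo_atom f n" for y
    unfolding horo_atom_def Ball_def in_ball_iff d_def by simp
  show "hmap E x0 f n = horo_atom f n"
    unfolding hmap_def horo_atom_iff
  proof (rule the_equality)
    show "horo_atom f n \<in> inf_atoms E x0 n \<and> (\<forall>y\<in>horo_atom f n. y \<in> horo_atom f n)"
      using horo_atom_inf_atom[OF assms] by blast
    fix A assume A: "A \<in> inf_atoms E x0 n \<and> (\<forall>y\<in>A. y \<in> horo_atom f n)"
    then obtain y where "y \<in> A" using inf_atom_nonempty by blast
    then show "A = horo_atom f n"
      using A inf_atom_eqI[of A n "horo_atom f n" y] horo_atom_inf_atom[OF assms] by blast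
  qed
qed

lemma hmap_bdry:
  assumes "f \<in> horo_bdry E x0"
  shows "hmap E x0 f \<in> atree_bdry E x0"
proof -
  have "horo_atom f (Suc n) \<subseteq> horo_atom f n" for n
  proof
    fix y assume "y \<in> horo_atom f (Suc n)"
    then show "y \<in> horo_atom f n" unfolding horo_atom_def by auto
  qed
  then show ?thesis
    unfolding hmap_eq[OF assms] atree_bdry_def using horo_atom_inf_atom[OF assms] by blast
qed

text \<open>A diagonal construction: the value at \<open>p\<close> is read off a vertex chosen in
  the atom of level \<open>d x0 p\<close>, and nestedness makes the values consistent. Surjectivity
  makes the \<open>inv_into\<close> in \<open>Lmap\<close> a right inverse.\<close>

lemma hmap_surj:
  assumes \<xi>: "\<xi> \<in> atree_bdry E x0"
  shows "\<xi> \<in> hmap E x0 ` horo_bdry E x0"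
proof -
  have "\<exists>y. y \<in> \<xi> n" for n using inf_atom_nonempty bdry_inf_atom[OF \<xi>] by blast
  then obtain y where y: "\<And>n. y n \<in> \<xi> n" by metis
  define f where "f p = ndist (y (d x0 p)) p" for p
  have f_eq: "f b = ndist z b" if z: "z \<in> \<xi> n" and b: "d x0 b \<le> n" for z n b
  proof -
    have "z \<in> \<xi> (d x0 b)" using bdry_antimono[OF \<xi> b] z by blast
    then have "z \<in> atom (d x0 b) (y (d x0 b))"
      using inf_atom_eq_atom[OF bdry_inf_atom[OF \<xi>] y] by blast
    then obtain c where
      c: "\<And>p. d x0 p \<le> d x0 b \<Longrightarrow> int (d z p) - int (d (y (d x0 b)) p) = c"
      unfolding in_atom_iff same_def by blast
    show ?thesis using c[of b] c[of x0] by (simp add: f_def ndist_def)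
  qed
  have "infinite {y. \<forall>b. d x0 b \<le> n \<longrightarrow> f b = ndist y b}" for n
  proof (rule infinite_super)
    show "\<xi> n \<subseteq> {y. \<forall>b. d x0 b \<le> n \<longrightarrow> f b = ndist y b}" using f_eq by blast
    show "infinite (\<xi> n)" using bdry_inf_atom[OF \<xi>] by (simp add: inf_atoms_iff)
  qed
  then have f: "f \<in> horo_bdry E x0" unfolding horo_bdry_iff by (simp add: f_def)
  have "hmap E x0 f = \<xi>"
  proof (rule bdry_eqI[OF hmap_bdry[OF f] \<xi>])
    fix k
    have "y k \<in> horo_atom f k" using agree_in_horo_atom[of k f] f_eq[OF y[of k]] by blast
    then show "\<exists>j\<ge>k. \<exists>z. z \<in> hmap E x0 f j \<and> z \<in> \<xi> j" using y hmap_eq[OF f] by auto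
  qed
  then show ?thesis using f by blast
qed

lemma horo_act_eq: "horo_act x0 G \<phi> a f p = f (\<phi> (inv a) p) - f (\<phi> (inv a) x0)"
  by (simp add: horo_act_def)

lemma dist_x0_inv_act:
  "a \<in> carrier G \<Longrightarrow> d x0 (\<phi> (inv a) b) \<le> d x0 b + d x0 (\<phi> (inv a) x0)"
  using d_tri[of x0 "\<phi> (inv a) b" "\<phi> (inv a) x0"] isom[OF inv_closed] by simp

lemma horo_act_horo_bdry:
  assumes a: "a \<in> carrier G" and f: "f \<in> horo_bdry E x0"
  shows "horo_act x0 G \<phi> a f \<in> horo_bdry E x0"
  unfolding horo_bdry_iff
proof (intro conjI allI)
  show "horo_act x0 G \<phi> a f x0 = 0" by (simp add: horo_act_eq)
  fix n
  let ?Y = "{y. \<forall>b. d x0 b \<le> n + d x0 (\<phi> (inv a) x0) \<longrightarrow> f b = ndist y b}"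
  show "infinite {y. \<forall>b. d x0 b \<le> n \<longrightarrow> horo_act x0 G \<phi> a f b = ndist y b}"
  proof (rule infinite_super)
    show "infinite (\<phi> a ` ?Y)" using f infinite_image_act[OF a] unfolding horo_bdry_iff by blast
    show "\<phi> a ` ?Y \<subseteq> {y. \<forall>b. d x0 b \<le> n \<longrightarrow> horo_act x0 G \<phi> a f b = ndist y b}"
    proof (intro image_subsetI CollectI allI impI)
      fix y b assume y: "y \<in> ?Y" and b: "d x0 b \<le> n"
      have "f (\<phi> (inv a) b) = ndist y (\<phi> (inv a) b)" "f (\<phi> (inv a) x0) = ndist y (\<phi> (inv a) x0)"
        using y dist_x0_inv_act[OF a, of b] b by auto
      then show "horo_act x0 G \<phi> a f b = ndist (\<phi> a y) b"
        by (simp add: horo_act_eq ndist_def dist_act_inv[OF a])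
    qed
  qed
qed

lemma act_horo_atom:
  assumes a: "a \<in> carrier G"
  shows "\<phi> a ` horo_atom f (n + d x0 (\<phi> (inv a) x0)) \<subseteq> horo_atom (horo_act x0 G \<phi> a f) n"
proof (rule image_subsetI)
  fix y assume "y \<in> horo_atom f (n + d x0 (\<phi> (inv a) x0))"
  then obtain c where c: "\<And>b. d x0 b \<le> n + d x0 (\<phi> (inv a) x0) \<Longrightarrow> f b - int (d y b) = c"
    unfolding horo_atom_def by blast
  have "horo_act x0 G \<phi> a f b - int (d (\<phi> a y) b) = c - f (\<phi> (inv a) x0)" if b: "d x0 b \<le> n" for b
    using c[of "\<phi> (inv a) b"] dist_x0_inv_act[OF a, of b] b
    by (simp add: horo_act_eq dist_act_inv[OF a])
  then show "\<phi> a y \<in> horo_atom (horo_act x0 G \<phi> a f) n" unfolding horo_atom_def by blast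
qed

text \<open>The level shift arises because \<open>\<phi> (inv a)\<close> maps a ball about
  \<open>x0\<close> into the concentric one larger by \<open>d x0 (\<phi> (inv a) x0)\<close>. Later
  arguments use \<open>Lmap\<close> only through these two facts.\<close>

lemma Lmap_works:
  assumes a: "a \<in> carrier G" and \<xi>: "\<xi> \<in> atree_bdry E x0"
  shows "Lmap E x0 G \<phi> a \<xi> \<in> atree_bdry E x0"
    and "\<phi> a ` \<xi> (n + d x0 (\<phi> (inv a) x0)) \<subseteq> Lmap E x0 G \<phi> a \<xi> n"
proof -
  define f where "f = inv_into (horo_bdry E x0) (hmap E x0) \<xi>"
  have f: "f \<in> horo_bdry E x0" "hmap E x0 f = \<xi>"
    unfolding f_def using hmap_surj[OF \<xi>] by (rule inv_into_into, rule f_inv_into_f)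
  have L: "Lmap E x0 G \<phi> a \<xi> = hmap E x0 (horo_act x0 G \<phi> a f)" by (simp add: Lmap_def f_def)
  show "Lmap E x0 G \<phi> a \<xi> \<in> atree_bdry E x0"
    unfolding L using hmap_bdry[OF horo_act_horo_bdry[OF a f(1)]] .
  have "\<xi> = horo_atom f" using f hmap_eq by simp
  then show "\<phi> a ` \<xi> (n + d x0 (\<phi> (inv a) x0)) \<subseteq> Lmap E x0 G \<phi> a \<xi> n"
    unfolding L hmap_eq[OF horo_act_horo_bdry[OF a f(1)]] using act_horo_atom[OF a] by simp
qed

section \<open>Local data determine types and restrictions\<close>

text \<open>Trades translated vertices for a translated centre, the form in which the geometric
  lemmas apply.\<close>

lemma same_act:
  assumes h: "h \<in> carrier G"
  shows "same x0 n (\<phi> h y) (\<phi> h z) \<longleftrightarrow> same (\<phi> (inv h) x0) n y z"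
proof -
  have "(\<forall>b. d x0 b \<le> n \<longrightarrow> int (d (\<phi> h z) b) - int (d (\<phi> h y) b) = c) \<longleftrightarrow>
      (\<forall>b. d (\<phi> (inv h) x0) b \<le> n \<longrightarrow> int (d z b) - int (d y b) = c)" (is "?L \<longleftrightarrow> ?R") for c
  proof (intro iffI allI impI)
    fix b assume "?L" "d (\<phi> (inv h) x0) b \<le> n"
    then show "int (d z b) - int (d y b) = c"
      using dist_inv_act[OF h, of x0 b] isom[OF h, of z b] isom[OF h, of y b] by metis
  next
    fix b assume "?R" "d x0 b \<le> n"
    then show "int (d (\<phi> h z) b) - int (d (\<phi> h y) b) = c"
      using isom[OF inv_closed[OF h], of x0 b] by (simp flip: dist_act_inv[OF h])
  qed
  then show ?thesis unfolding same_def by simp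
qed

lemma atom_act:
  assumes "h \<in> carrier G"
  shows "atom n (\<phi> h y) = \<phi> h ` {z. same (\<phi> (inv h) x0) n y z}"
proof (intro equalityI subsetI)
  fix z assume "z \<in> atom n (\<phi> h y)"
  then have "same x0 n (\<phi> h y) (\<phi> h (\<phi> (inv h) z))"
    by (simp add: in_atom_iff act_inv_right[OF assms])
  then have "\<phi> (inv h) z \<in> {z. same (\<phi> (inv h) x0) n y z}" using same_act[OF assms] by simp
  then show "z \<in> \<phi> h ` {z. same (\<phi> (inv h) x0) n y z}"
    using act_inv_right[OF assms, of z] by (metis imageI)
qed (auto simp: in_atom_iff same_act[OF assms])

lemma proj_act:
  assumes "h \<in> carrier G"
  shows "proj x m (\<phi> h y) (\<phi> h p) \<longleftrightarrow> proj (\<phi> (inv h) x) m y p"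
proof (intro iffI)
  assume L: "proj x m (\<phi> h y) (\<phi> h p)"
  show "proj (\<phi> (inv h) x) m y p" unfolding proj_def
  proof (intro conjI allI impI)
    show "d (\<phi> (inv h) x) p \<le> m" using proj_in_ball[OF L] by (simp add: dist_inv_act[OF assms])
    show "d y p \<le> d y b" if "d (\<phi> (inv h) x) b \<le> m" for b
      using proj_le[OF L, of "\<phi> h b"] that by (simp add: dist_inv_act[OF assms] isom[OF assms])
  qed
next
  assume R: "proj (\<phi> (inv h) x) m y p"
  show "proj x m (\<phi> h y) (\<phi> h p)" unfolding proj_def
  proof (intro conjI allI impI)
    show "d x (\<phi> h p) \<le> m" using proj_in_ball[OF R] by (simp add: dist_inv_act[OF assms])
    show "d (\<phi> h y) (\<phi> h p) \<le> d (\<phi> h y) b" if "d x b \<le> m" for b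
      using proj_le[OF R, of "\<phi> (inv h) b"] that
      by (simp add: act_inv_right[OF assms] dist_act_inv[OF assms] isom[OF assms])
  qed
qed

text \<open>All vertices of \<open>A\<close> share the projection \<open>p\<close>, so agreement
  near this one point controls their depths and all finer atoms at once. The vertex \<open>z\<close>
  fixes \<open>p\<close> and the target atom.\<close>

lemma induces_mor_if_agree:
  assumes g: "g \<in> carrier G"
    and A: "A \<in> inf_atoms E x0 m" "z \<in> A" and A': "A' \<in> inf_atoms E x0 n" "\<phi> g z \<in> A'"
    and p: "proj x0 m z p" and ag: "agree R1 p x0 m (\<phi> (inv g) x0) n"
  shows "induces_mor E x0 G \<phi> g (m, A) (n, A')"
proof -
  have same_z: "same x0 m z y" if "y \<in> A" for y
    using that inf_atom_eq_atom[OF A] in_atom_iff[of y m z] by simp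
  have proj_A: "proj x0 m y p" if "y \<in> A" for y using same_proj[OF same_z[OF that] p] .
  have image_atom: "\<phi> g ` atom (m + k) y = atom (n + k) (\<phi> g y)" if "y \<in> A" for y k
    unfolding atom_act[OF g] using agree_same_iff[OF ag proj_A[OF that]] by (simp add: atom_def)
  have image_A: "\<phi> g ` A = A'"
    using image_atom[OF A(2), of 0] inf_atom_eq_atom[OF A] inf_atom_eq_atom[OF A'] by simp
  have dist: "d x0 (\<phi> g y) \<le> n + k \<longleftrightarrow> d x0 y \<le> m + k" if "y \<in> A" for y k
  proof -
    have "d x0 y + n = d x0 (\<phi> g y) + m"
      using agree_dist[OF ag _ proj_A[OF that]] by (simp add: R1_def dist_inv_act[OF g])
    then show ?thesis by linarith
  qed
  show ?thesis
  proof (rule induces_morI)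
    show "g \<in> carrier G" "(m, A) \<in> atree E x0" "(n, A') \<in> atree E x0"
      using g A(1) A'(1) by (simp_all add: atree_def)
    show "\<phi> g ` snd (m, A) = snd (n, A')" using image_A by simp
    show "\<phi> g ` (snd (m, A) \<inter> ball E x0 (fst (m, A) + k)) = snd (n, A') \<inter> ball E x0 (fst (n, A') + k)" for k
      unfolding image_A[symmetric] using dist by (auto simp: in_ball_iff)
    show "\<phi> g ` C \<in> inf_atoms E x0 (fst (n, A') + k)"
      if C: "C \<in> inf_atoms E x0 (fst (m, A) + k)" "C \<subseteq> snd (m, A)" for k C
    proof -
      have C': "C \<in> inf_atoms E x0 (m + k)" using C(1) by simp
      obtain y where y: "y \<in> C" using inf_atom_nonempty[OF C'] by blast
      have "\<phi> g ` C = atom (n + k) (\<phi> g y)"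
        using image_atom[of y k] inf_atom_eq_atom[OF C' y] y C(2) by auto
      moreover have "infinite (\<phi> g ` C)"
        using C' infinite_image_act[OF g] by (simp add: inf_atoms_iff)
      ultimately show ?thesis unfolding inf_atoms_iff by auto
    qed
  qed
qed

text \<open>The smaller ball lies in the larger one and contains all points of it at depth \<open>2 * d x x'\<close>.\<close>
lemma proj_change_base:
  assumes p: "proj x m z p" and p': "proj x' (m - d x x') z p'" and m: "2 * d x x' \<le> m"
  shows "d p p' \<le> 2 * d x x' + 2 * K"
proof -
  define l where "l = d x x'"
  have "d x p' \<le> m"
    using proj_in_ball[OF p'] d_tri[of x p' x'] m by linarith
  then have lb: "d z p + d p p' \<le> d z p' + 2 * K" using proj_lower_bound[OF p] by blast
  have "min (2 * l) (d p x) \<le> d p x" by simp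
  then obtain q where q: "d p q = min (2 * l) (d p x)" "d p q + d q x = d p x" using geodesic by blast
  have "d x' q \<le> m - l"
    using q proj_in_ball[OF p] d_tri[of x' q x] d_sym[of x q] d_sym[of p x] d_sym[of x' x] m
    unfolding l_def by linarith
  then have "d z p' \<le> d z q" using proj_le[OF p'] by (simp add: l_def)
  then show ?thesis using lb d_tri[of z q p] q unfolding l_def by linarith
qed

text \<open>On the target side the projection \<open>p'\<close> is taken to the ball about
  \<open>\<phi> (inv a) x0\<close>. By \<open>proj_change_base\<close> it lies within
  \<open>2 * l + 2 * K\<close> of \<open>p\<close>, so the radius in \<open>ag2\<close> leaves
  \<open>R1\<close> around \<open>p'\<close>.\<close>

lemma restr_equiv_if_agree:
  assumes a: "a \<in> carrier G" and l_def: "l = d x0 (\<phi> (inv a) x0)"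
    and A: "A \<in> inf_atoms E x0 m" "z \<in> A" and A': "A' \<in> inf_atoms E x0 n" "\<phi> g1 z \<in> A'"
    and m: "2 * l \<le> m" and n: "2 * l \<le> n" and g1: "g1 \<in> carrier G"
    and p: "proj x0 m z p"
    and ag1: "agree (R1 + 2 * l + 2 * K) p x0 m (\<phi> (inv g1) x0) n"
    and ag2: "agree (R1 + 2 * l + 2 * K) p (\<phi> (inv a) x0) m (\<phi> (inv g1) (\<phi> (inv a) x0)) n"
  shows "equiv_restr E x0 G \<phi> (Lmap E x0 G \<phi> a) (m, A) (n, A')"
proof -
  define g2 where "g2 = a \<otimes> g1 \<otimes> inv a"
  have ag1_carrier: "a \<otimes> g1 \<in> carrier G" using mult_closed a g1 by blast
  have g2: "g2 \<in> carrier G" unfolding g2_def using mult_closed[OF ag1_carrier inv_closed[OF a]] .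
  have g2_act: "\<phi> g2 (\<phi> a y) = \<phi> a (\<phi> g1 y)" for y
    unfolding g2_def act_mult[OF ag1_carrier inv_closed[OF a]] act_inv_left[OF a] act_mult[OF a g1] ..
  \<comment> \<open>Applying \<open>a\<close> costs \<open>l\<close> levels; by
    \<open>L_level\<close> every vertex of \<open>A\<close> would give the same atom.\<close>
  define C where "C = atom (m - l) (\<phi> a z)"
  define C' where "C' = atom (n - l) (\<phi> a (\<phi> g1 z))"
  have L_level: "Lmap E x0 G \<phi> a \<xi> (k - l) = atom (k - l) (\<phi> a y)"
    if "\<xi> \<in> atree_bdry E x0" "y \<in> \<xi> k" "l \<le> k" for \<xi> k y
  proof (rule inf_atom_eq_atom[OF bdry_inf_atom[OF Lmap_works(1)[OF a that(1)]]])
    show "\<phi> a y \<in> Lmap E x0 G \<phi> a \<xi> (k - l)"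
      using Lmap_works(2)[OF a that(1), of "k - l"] that(2,3) by (auto simp: l_def)
  qed
  have L_C: "Lmap E x0 G \<phi> a ` bdry_at E x0 (k, B) \<subseteq> bdry_at E x0 (k - l, atom (k - l) (\<phi> a y))"
    if "y \<in> B" "l \<le> k" for k B y
  proof (rule image_subsetI)
    fix \<xi> assume \<xi>: "\<xi> \<in> bdry_at E x0 (k, B)"
    have "y \<in> \<xi> k" using bdry_at_level[OF \<xi>] that(1) by simp
    then show "Lmap E x0 G \<phi> a \<xi> \<in> bdry_at E x0 (k - l, atom (k - l) (\<phi> a y))"
      using L_level[OF bdry_at_bdry[OF \<xi>] _ that(2)] Lmap_works(1)[OF a bdry_at_bdry[OF \<xi>]]
      by (simp add: bdry_at_def)
  qed
  \<comment> \<open>This atom is infinite because it occurs on the image of a ray through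
    \<open>B\<close>.\<close>
  have L_inf: "atom (k - l) (\<phi> a y) \<in> inf_atoms E x0 (k - l)"
    if B: "B \<in> inf_atoms E x0 k" "y \<in> B" "l \<le> k" for k B y
  proof -
    have "(k, B) \<in> atree E x0" using B(1) by (simp add: atree_def)
    then obtain \<xi> where \<xi>: "\<xi> \<in> bdry_at E x0 (k, B)" using bdry_at_nonempty by blast
    have "y \<in> \<xi> k" using bdry_at_level[OF \<xi>] B(2) by simp
    then have "Lmap E x0 G \<phi> a \<xi> (k - l) = atom (k - l) (\<phi> a y)"
      using L_level[OF bdry_at_bdry[OF \<xi>] _ B(3)] by simp
    then show ?thesis using bdry_inf_atom[OF Lmap_works(1)[OF a bdry_at_bdry[OF \<xi>]], of "k - l"] by simp
  qed
  have C: "C \<in> inf_atoms E x0 (m - l)" and C': "C' \<in> inf_atoms E x0 (n - l)"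
    unfolding C_def C'_def using L_inf[OF A] L_inf[OF A'] m n by simp_all
  have mor1: "induces_mor E x0 G \<phi> g1 (m, A) (n, A')"
    by (rule induces_mor_if_agree[OF g1 A A' p agree_mono[OF ag1]]) simp
  obtain p' where p': "proj (\<phi> (inv a) x0) (m - l) z p'" using proj_exists by blast
  have mor2: "induces_mor E x0 G \<phi> g2 (m - l, C) (n - l, C')"
  proof (rule induces_mor_if_agree[OF g2 C _ C'])
    show "\<phi> a z \<in> C" unfolding C_def by (rule atom_self)
    show "\<phi> g2 (\<phi> a z) \<in> C'" unfolding C'_def g2_act by (rule atom_self)
    show "proj x0 (m - l) (\<phi> a z) (\<phi> a p')" unfolding proj_act[OF a] using p' .
    have "d p p' \<le> 2 * l + 2 * K"
      using proj_change_base[OF p, of "\<phi> (inv a) x0" p'] p' m by (simp add: l_def)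
    then have ag: "agree R1 p' (\<phi> (inv a) x0) m (\<phi> (inv g1) (\<phi> (inv a) x0)) n"
      using agree_shift[OF ag2, of p' R1] by simp
    \<comment> \<open>Both radii drop by the same \<open>l\<close>, so agreement for
      \<open>m\<close> and \<open>n\<close> carries over; \<open>m\<close> and \<open>n\<close> are
      at least \<open>l\<close>, so the subtractions are exact.\<close>
    show "agree R1 (\<phi> a p') x0 (m - l) (\<phi> (inv g2) x0) (n - l)" unfolding agree_def
    proof (intro allI impI)
      fix s assume s: "d (\<phi> a p') s \<le> R1"
      define t where "t = \<phi> (inv a) s"
      have s_eq: "s = \<phi> a t" unfolding t_def act_inv_right[OF a] ..
      have "d (\<phi> (inv a) x0) t + n = d (\<phi> (inv g1) (\<phi> (inv a) x0)) t + m"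
        using ag s unfolding agree_def s_eq isom[OF a] by blast
      then have "d x0 (\<phi> a t) + n = d x0 (\<phi> a (\<phi> g1 t)) + m"
        by (simp add: dist_inv_act[OF a] dist_inv_act[OF g1])
      then show "d x0 s + (n - l) = d (\<phi> (inv g2) x0) s + (m - l)"
        unfolding s_eq dist_inv_act[OF g2] g2_act using m n by linarith
    qed
  qed
  have comm: "Lmap E x0 G \<phi> a (mor_push E x0 \<phi> g1 (m, A) (n, A') \<xi>) =
      mor_push E x0 \<phi> g2 (m - l, C) (n - l, C') (Lmap E x0 G \<phi> a \<xi>)"
    if \<xi>: "\<xi> \<in> bdry_at E x0 (m, A)" for \<xi>
  proof (rule mor_push_eqI[OF mor2, symmetric])
    show "Lmap E x0 G \<phi> a \<xi> \<in> bdry_at E x0 (m - l, C)" using L_C[OF A(2), of m] \<xi> m C_def by auto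
    note push = mor_push_works[OF mor1 \<xi>]
    show "Lmap E x0 G \<phi> a (mor_push E x0 \<phi> g1 (m, A) (n, A') \<xi>) \<in> atree_bdry E x0"
      using Lmap_works(1)[OF a bdry_at_bdry[OF push(1)]] .
    fix k
    obtain y where y: "y \<in> \<xi> (m + k)"
      using inf_atom_nonempty bdry_inf_atom bdry_at_bdry[OF \<xi>] by blast
    have "\<phi> a y \<in> Lmap E x0 G \<phi> a \<xi> (m - l + k)"
      using Lmap_works(2)[OF a bdry_at_bdry[OF \<xi>], of "m - l + k"] y m by (auto simp flip: l_def)
    moreover have "\<phi> g1 y \<in> mor_push E x0 \<phi> g1 (m, A) (n, A') \<xi> (n + k)"
      using push(2)[of k] y by simp
    then have "\<phi> a (\<phi> g1 y) \<in> Lmap E x0 G \<phi> a (mor_push E x0 \<phi> g1 (m, A) (n, A') \<xi>) (n - l + k)"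
      using Lmap_works(2)[OF a bdry_at_bdry[OF push(1)], of "n - l + k"] n by (auto simp flip: l_def)
    ultimately show "\<exists>y\<in>Lmap E x0 G \<phi> a \<xi> (fst (m - l, C) + k).
        \<phi> g2 y \<in> Lmap E x0 G \<phi> a (mor_push E x0 \<phi> g1 (m, A) (n, A') \<xi>) (fst (n - l, C') + k)"
      unfolding fst_conv using g2_act by metis
  qed
  have "restr_wit (Lmap E x0 G \<phi> a) (m, A) (n, A') g1 (m - l, C) (n - l, C') g2"
    unfolding restr_wit_def
    using mor1 mor2 comm L_C[OF A(2), of m] L_C[OF A'(2), of n] m n by (simp add: C_def C'_def)
  then show ?thesis unfolding equiv_restr_iff_wit by blast
qed

section \<open>Cocompactness and the finite number of local pictures\<close>

lemma orbit_representatives: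
  assumes "finite (orbits G UNIV \<phi>)"
  shows "\<exists>S. finite S \<and> (\<forall>p. \<exists>h\<in>carrier G. \<phi> h p \<in> S)"
proof (intro exI conjI allI)
  let ?rep = "\<lambda>Q. SOME x. x \<in> Q"
  show "finite (?rep ` orbits G UNIV \<phi>)" using assms by (rule finite_imageI)
  fix p
  have "?rep (orbit G \<phi> p) \<in> orbit G \<phi> p"
    by (rule someI[of _ p]) (rule group_action.orbit_refl[OF act UNIV_I])
  then obtain h where "h \<in> carrier G" "\<phi> h p = ?rep (orbit G \<phi> p)"
    unfolding orbit_def by auto
  moreover have "orbit G \<phi> p \<in> orbits G UNIV \<phi>" unfolding orbits_def by blast
  ultimately show "\<exists>h\<in>carrier G. \<phi> h p \<in> ?rep ` orbits G UNIV \<phi>" by (metis imageI)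
qed

text \<open>An infinite atom leaves the ball, and outside vertices project to the sphere. With
  \<open>p\<close> on the sphere, depths near \<open>p\<close> are bounded independently of
  \<open>m\<close>.\<close>

lemma inf_atom_proj_on_sphere:
  assumes A: "A \<in> inf_atoms E x0 m"
  shows "\<exists>z p. z \<in> A \<and> proj x0 m z p \<and> d x0 p = m"
proof -
  have "infinite (A - {y. d x0 y \<le> m})"
    using A finite_ball[of x0 m] by (simp add: inf_atoms_iff)
  then have "A - {y. d x0 y \<le> m} \<noteq> {}" by (metis finite.emptyI)
  then obtain z where z: "z \<in> A" "\<not> d x0 z \<le> m" by blast
  obtain p where p: "proj x0 m z p" using proj_exists by blast
  have "z \<noteq> p" using proj_in_ball[OF p] z(2) by auto
  then have "d x0 p = m"
    using proj_dist_outside[OF p] proj_in_ball[OF p] d_tri[of x0 z p] d_sym[of z p] by simp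
  then show ?thesis using z(1) p by blast
qed

lemma abs_dist_diff_le: "\<bar>int (d x y) - int (d x z)\<bar> \<le> int (d y z)"
  using d_tri[of x y z] d_tri[of x z y] d_sym[of y z] by linarith

text \<open>The data are translated by \<open>h\<close>, which moves \<open>p\<close> to one of finitely many orbit representatives,
  so that only finitely many values occur.\<close>
definition local_data :: "nat \<Rightarrow> 'a \<Rightarrow> nat \<Rightarrow> 'a \<times> 'a \<times> 'c \<Rightarrow> 'a \<times> ('a \<Rightarrow> int \<times> int \<times> int)" where
  "local_data R x m = (\<lambda>(z, p, h). (\<phi> h p, \<lambda>s\<in>{s. d (\<phi> h p) s \<le> R}.
     (int (d x0 (\<phi> (inv h) s)) - int m, int (d x (\<phi> (inv h) s)) - int m,
      if d x0 (\<phi> (inv h) s) \<le> m then int (d z (\<phi> (inv h) s)) - int (d z p) else 0)))"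

lemma local_data_bounded:
  assumes h: "h \<in> carrier G" and p: "d x0 p = m" and C_def: "C = int (R + d x0 x)"
  shows "snd (local_data R x m (z, p, h)) \<in>
    {s. d (\<phi> h p) s \<le> R} \<rightarrow>\<^sub>E {- C..C} \<times> {- C..C} \<times> {- C..C}"
  unfolding local_data_def prod.case snd_conv
proof (rule restrict_PiE_iff[THEN iffD2], rule ballI)
  fix s assume "s \<in> {s. d (\<phi> h p) s \<le> R}"
  then have s: "d (\<phi> (inv h) s) p \<le> R"
    using dist_act_inv[OF h, of p s] by (simp add: d_sym)
  have "\<bar>int (d x0 (\<phi> (inv h) s)) - int m\<bar> \<le> C"
    using abs_dist_diff_le[of x0 "\<phi> (inv h) s" p] s p by (simp add: C_def)
  moreover have "\<bar>int (d x (\<phi> (inv h) s)) - int m\<bar> \<le> C"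
    using abs_dist_diff_le[of "\<phi> (inv h) s" x x0] abs_dist_diff_le[of x0 "\<phi> (inv h) s" p] s p
      d_sym[of x "\<phi> (inv h) s"] d_sym[of x0 "\<phi> (inv h) s"] d_sym[of x x0] by (simp add: C_def)
  moreover have "\<bar>int (d z (\<phi> (inv h) s)) - int (d z p)\<bar> \<le> C"
    using abs_dist_diff_le[of z "\<phi> (inv h) s" p] s by (simp add: C_def)
  moreover have "0 \<le> C" by (simp add: C_def)
  ultimately show "(int (d x0 (\<phi> (inv h) s)) - int m, int (d x (\<phi> (inv h) s)) - int m,
      if d x0 (\<phi> (inv h) s) \<le> m then int (d z (\<phi> (inv h) s)) - int (d z p) else 0)
    \<in> {- C..C} \<times> {- C..C} \<times> {- C..C}"
    by (simp add: abs_le_iff)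
qed

text \<open>Equal representatives make \<open>inv h' \<otimes> h\<close> carry \<open>p\<close> to
  \<open>p'\<close>. The first two recorded functions give the two agreement hypotheses; the third
  shows that the pulled back vertex \<open>z1\<close> lies in \<open>A\<close>.\<close>

lemma equiv_restr_if_local_data_eq:
  assumes a: "a \<in> carrier G" and l_def: "l = d x0 (\<phi> (inv a) x0)"
    and R_def: "R = R1 + 2 * l + 2 * K"
    and A: "A \<in> inf_atoms E x0 m" "z \<in> A" and A': "A' \<in> inf_atoms E x0 n" "z' \<in> A'"
    and m: "2 * l \<le> m" and n: "2 * l \<le> n"
    and h: "h \<in> carrier G" and h': "h' \<in> carrier G"
    and p: "proj x0 m z p" and p': "proj x0 n z' p'"
    and eq: "local_data R (\<phi> (inv a) x0) m (z, p, h) = local_data R (\<phi> (inv a) x0) n (z', p', h')"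
  shows "equiv_restr E x0 G \<phi> (Lmap E x0 G \<phi> a) (m, A) (n, A')"
proof -
  define g1 where "g1 = inv h' \<otimes> h"
  have g1: "g1 \<in> carrier G" unfolding g1_def using mult_closed inv_closed h h' by blast
  have g1_act: "\<phi> g1 b = \<phi> (inv h') (\<phi> h b)" for b
    unfolding g1_def act_mult[OF inv_closed[OF h'] h] ..
  have hp: "\<phi> h p = \<phi> h' p'" using eq by (simp add: local_data_def)
  have g1p: "\<phi> g1 p = p'" unfolding g1_act hp act_inv_left[OF h'] ..
  have data: "int (d x0 b) - int m = int (d x0 (\<phi> g1 b)) - int n \<and>
      int (d (\<phi> (inv a) x0) b) - int m = int (d (\<phi> (inv a) x0) (\<phi> g1 b)) - int n \<and>
      (if d x0 b \<le> m then int (d z b) - int (d z p) else 0) =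
      (if d x0 (\<phi> g1 b) \<le> n then int (d z' (\<phi> g1 b)) - int (d z' p') else 0)"
    if b: "d p b \<le> R" for b
  proof -
    have "d (\<phi> h p) (\<phi> h b) \<le> R" "d (\<phi> h' p') (\<phi> h b) \<le> R" using b by (simp_all add: isom[OF h] flip: hp)
    then show ?thesis
      using fun_cong[OF arg_cong[OF eq, of snd], of "\<phi> h b"]
      by (simp only: local_data_def prod.case snd_conv restrict_apply mem_Collect_eq if_True
          act_inv_left[OF h] g1_act[symmetric] prod.inject)
  qed
  have ag1: "agree R p x0 m (\<phi> (inv g1) x0) n" unfolding agree_def
  proof (intro allI impI)
    fix b assume "d p b \<le> R"
    then show "d x0 b + n = d (\<phi> (inv g1) x0) b + m"
      using data[of b] unfolding dist_inv_act[OF g1] by linarith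
  qed
  have ag2: "agree R p (\<phi> (inv a) x0) m (\<phi> (inv g1) (\<phi> (inv a) x0)) n" unfolding agree_def
  proof (intro allI impI)
    fix b assume "d p b \<le> R"
    then show "d (\<phi> (inv a) x0) b + n = d (\<phi> (inv g1) (\<phi> (inv a) x0)) b + m"
      using data[of b] unfolding dist_inv_act[OF g1, of "\<phi> (inv a) x0"] by linarith
  qed
  define z1 where "z1 = \<phi> (inv g1) z'"
  have g1z1: "\<phi> g1 z1 = z'" unfolding z1_def act_inv_right[OF g1] ..
  have "proj (\<phi> (inv g1) x0) n z1 p"
    unfolding proj_act[OF g1, symmetric] g1z1 g1p using p' .
  then have z1_proj: "proj x0 m z1 p"
    using agree_proj_iff[OF ag1] by (simp add: R_def)
  have "same x0 m z z1"
  proof (rule same_if_same_near_proj[OF p z1_proj])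
    fix b assume b: "d x0 b \<le> m" "d p b \<le> R0"
    have "d p b \<le> R" using b(2) by (simp add: R_def R1_def)
    \<comment> \<open>Equal depths put \<open>\<phi> g1 b\<close> in the ball of radius
      \<open>n\<close>, so neither conditional takes its default 0.\<close>
    from data[OF this] b(1) have "int (d z b) - int (d z p) = int (d z' (\<phi> g1 b)) - int (d z' p')"
      by (auto split: if_splits)
    then show "d z b + d z1 p = d z1 b + d z p"
      unfolding z1_def dist_inv_act[OF g1] g1p by linarith
  qed
  then have z1: "z1 \<in> A" using inf_atom_eq_atom[OF A] by (simp add: in_atom_iff)
  have z1': "\<phi> g1 z1 \<in> A'" using A'(2) g1z1 by simp
  show ?thesis
    using restr_equiv_if_agree[OF a l_def A(1) z1 A'(1) z1' m n g1 z1_proj] ag1 ag2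
    by (simp add: R_def)
qed

lemma rational_Lmap:
  assumes a: "a \<in> carrier G" and cocompact: "finite (orbits G UNIV \<phi>)"
  shows "rational_map E x0 G \<phi> (Lmap E x0 G \<phi> a)"
proof -
  define l where "l = d x0 (\<phi> (inv a) x0)"
  define R where "R = R1 + 2 * l + 2 * K"
  obtain S where S: "finite S" "\<forall>p. \<exists>h\<in>carrier G. \<phi> h p \<in> S"
    using orbit_representatives[OF cocompact] by blast
  \<comment> \<open>The bound comes from \<open>proj_change_base\<close>. The other vertices lie on
    finitely many levels, each with finitely many atoms.\<close>
  define T where "T = {v \<in> atree E x0. 2 * l \<le> fst v}"
  define cls where "cls v = {w. equiv_restr E x0 G \<phi> (Lmap E x0 G \<phi> a) v w}" for v
  have "\<forall>v\<in>T. \<exists>t. fst t \<in> snd v \<and> proj x0 (fst v) (fst t) (fst (snd t)) \<and>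
      d x0 (fst (snd t)) = fst v \<and> snd (snd t) \<in> carrier G \<and> \<phi> (snd (snd t)) (fst (snd t)) \<in> S"
  proof
    fix v assume "v \<in> T"
    then have "snd v \<in> inf_atoms E x0 (fst v)" using atree_inf_atom by (simp add: T_def)
    then obtain z p where zp: "z \<in> snd v" "proj x0 (fst v) z p" "d x0 p = fst v"
      using inf_atom_proj_on_sphere by blast
    obtain h where "h \<in> carrier G" "\<phi> h p \<in> S" using S(2) by blast
    then show "\<exists>t. fst t \<in> snd v \<and> proj x0 (fst v) (fst t) (fst (snd t)) \<and>
        d x0 (fst (snd t)) = fst v \<and> snd (snd t) \<in> carrier G \<and> \<phi> (snd (snd t)) (fst (snd t)) \<in> S"
      using zp by (intro exI[of _ "(z, p, h)"]) simp
  qed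
  from bchoice[OF this] obtain t where t: "\<And>v. v \<in> T \<Longrightarrow> fst (t v) \<in> snd v \<and>
      proj x0 (fst v) (fst (t v)) (fst (snd (t v))) \<and> d x0 (fst (snd (t v))) = fst v \<and>
      snd (snd (t v)) \<in> carrier G \<and> \<phi> (snd (snd (t v))) (fst (snd (t v))) \<in> S"
    by blast
  define C where "C = int (R + l)"
  define dat where "dat v = local_data R (\<phi> (inv a) x0) (fst v) (t v)" for v
  have "finite (cls ` T)"
  proof (rule finite_image_factor)
    \<comment> \<open>The domain of the recorded function depends on the representative
      \<open>r\<close>, hence a dependent sum over \<open>S\<close>.\<close>
    let ?D = "SIGMA r:S. {s. d r s \<le> R} \<rightarrow>\<^sub>E {- C..C} \<times> {- C..C} \<times> {- C..C}"
    have "dat ` T \<subseteq> ?D"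
    proof (rule image_subsetI)
      fix v assume v: "v \<in> T"
      obtain z p h where tv: "t v = (z, p, h)" by (metis prod_cases3)
      have "h \<in> carrier G" "d x0 p = fst v" "\<phi> h p \<in> S" using t[OF v] by (simp_all add: tv)
      moreover from this(1,2) have "snd (dat v) \<in> {s. d (\<phi> h p) s \<le> R} \<rightarrow>\<^sub>E {- C..C} \<times> {- C..C} \<times> {- C..C}"
        unfolding dat_def tv by (rule local_data_bounded) (simp add: C_def l_def)
      moreover have "fst (dat v) = \<phi> h p" by (simp add: dat_def tv local_data_def)
      ultimately show "dat v \<in> ?D" by (cases "dat v") simp
    qed
    moreover have "finite ?D"
      using S(1) finite_ball by (intro finite_SigmaI finite_PiE) simp_all
    ultimately show "finite (dat ` T)" by (rule finite_subset)
    fix v w assume v: "v \<in> T" and w: "w \<in> T" and eq: "dat v = dat w"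
    have "snd v \<in> inf_atoms E x0 (fst v)" "snd w \<in> inf_atoms E x0 (fst w)" "2 * l \<le> fst v" "2 * l \<le> fst w"
      using v w atree_inf_atom by (auto simp: T_def)
    then have "equiv_restr E x0 G \<phi> (Lmap E x0 G \<phi> a) (fst v, snd v) (fst w, snd w)"
      using equiv_restr_if_local_data_eq[OF a l_def R_def, of "snd v" "fst v" "fst (t v)" "snd w" "fst w" "fst (t w)"
          "snd (snd (t v))" "snd (snd (t w))" "fst (snd (t v))" "fst (snd (t w))"] t[OF v] t[OF w] eq
      unfolding dat_def by simp
    then have vw: "equiv_restr E x0 G \<phi> (Lmap E x0 G \<phi> a) v w" by simp
    show "cls v = cls w"
      unfolding cls_def using equiv_restr_trans[OF vw] equiv_restr_trans[OF equiv_restr_sym[OF vw]] by blast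
  qed
  moreover have "finite (cls ` (SIGMA n:{..<2 * l}. inf_atoms E x0 n))"
    using finite_inf_atoms by (intro finite_imageI finite_SigmaI) simp_all
  moreover have "atree E x0 // {(v, w). equiv_restr E x0 G \<phi> (Lmap E x0 G \<phi> a) v w} \<subseteq>
      cls ` T \<union> cls ` (SIGMA n:{..<2 * l}. inf_atoms E x0 n)"
  proof
    fix Q assume "Q \<in> atree E x0 // {(v, w). equiv_restr E x0 G \<phi> (Lmap E x0 G \<phi> a) v w}"
    then obtain v where v: "v \<in> atree E x0" "Q = cls v"
      unfolding quotient_def cls_def by auto
    have "v \<in> T \<or> v \<in> (SIGMA n:{..<2 * l}. inf_atoms E x0 n)"
      using v(1) by (cases v) (auto simp: T_def atree_def)
    then show "Q \<in> cls ` T \<union> cls ` (SIGMA n:{..<2 * l}. inf_atoms E x0 n)" using v(2) by blast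
  qed
  ultimately show ?thesis
    unfolding rational_map_def by (meson finite_UnI finite_subset)
qed

end

theorem mainTheorem20:
  fixes E :: "'v \<Rightarrow> 'v \<Rightarrow> bool" and x0 :: 'v
    and G :: "('g, 'b) monoid_scheme" and \<phi> :: "'g \<Rightarrow> 'v \<Rightarrow> 'v" and g :: 'g
  assumes sym: "\<And>x y. E x y \<Longrightarrow> E y x"
    and irrefl: "\<And>x. \<not> E x x"
    and locfin: "locally_finite E"
    and conn: "graph_connected E"
    and hyp: "hyperbolic_graph E"
    and act: "group_action G UNIV \<phi>"
    and isom: "\<And>h x y. h \<in> carrier G \<Longrightarrow> gdist E (\<phi> h x) (\<phi> h y) = gdist E x y"
    and proper: "\<And>x. finite (stabilizer G \<phi> x)"
    and cocompact: "finite (orbits G UNIV \<phi>)"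
    and g: "g \<in> carrier G"
  shows "rational_map E x0 G \<phi> (Lmap E x0 G \<phi> g)"
proof -
  obtain D where "hyperbolic_space E D" using hyperbolic_spaceI[OF sym locfin conn hyp] by blast
  then have "hyperbolic_action E D G \<phi>"
    using act isom by (simp add: hyperbolic_action_def hyperbolic_action_axioms_def)
  then show ?thesis using g cocompact by (rule hyperbolic_action.rational_Lmap)
qed

end
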